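(* Let $\pmb k$ be a field, $B=\pmb k[x,y]$ and $d=2c$ an even integer. If every polynomial in $\pmb k[x]$ of degree $2$ or $3$ has a root in the field $\pmb k$, then the space of balanced Hilbert-Burch matrices $\operatorname{BalH}_d$ is the disjoint union of the orbits $\operatorname{DO}^{\rm Bal}_{\natural}$ as $\natural$ varies over the eleven-element set $\operatorname{ECP}$, where $\operatorname{BalH}_d$, $\operatorname{ECP}$, and $\operatorname{DO}^{\rm Bal}_\natural$ are defined in the context.
   Context: $B=\pmb k[x,y]$ is standard graded with degree $c$ component $B_c$. $\operatorname{BalH}_d$ is the set of $3\times2$ matrices $\varphi$ with entries in $B_c$ such that the ideal $I_2(\varphi)$ generated by the $2\times 2$ minors has height $2$. The group $G=\operatorname{GL}_3(\pmb k)\times\operatorname{GL}_2(\pmb k)$ acts on $\operatorname{BalH}_d$ by $(\chi,\xi)\cdot\varphi=\chi\varphi\xi^{-1}$. $\operatorname{ECP}$ is the set of eleven symbols $$\mu_2,\ c:c:c,\ c:c,c,\ c,c,c,\ c:c,\ c,c,\ (c,\mu_4),\ (c,\mu_5),\ (\emptyset,\mu_4),\ (\emptyset,\mu_5),\ (\emptyset,\mu_6)$$ (so, for example, "$c:c,c$" and "$c,c,c$" are single symbols). For each $\natural\in\operatorname{ECP}$, let $M^{\rm Bal}_\natural$ be the set of all matrices in $\operatorname{BalH}_d$ of the following form, where in each case all the distinct forms $Q_i\in B_c$ appearing in the matrix are required to be linearly independent over $\pmb k$: $$M^{\rm Bal}_{\mu_2}:\begin{bmatrix}Q_1&0\\Q_2&Q_1\\0&Q_2\end{bmatrix},\quad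 M^{\rm Bal}_{c:c:c}:\begin{bmatrix}Q_1&Q_2\\Q_3&Q_1\\0&Q_3\end{bmatrix},\quad M^{\rm Bal}_{c:c,c}:\begin{bmatrix}Q_1&0\\Q_2&Q_3\\0&Q_2\end{bmatrix},\quad M^{\rm Bal}_{c,c,c}:\begin{bmatrix}Q_1&Q_1\\Q_2&0\\0&Q_3\end{bmatrix},$$ $$M^{\rm Bal}_{c:c}:\begin{bmatrix}Q_1&Q_2\\Q_3&Q_4\\0&Q_3\end{bmatrix},\quad M^{\rm Bal}_{c,c}:\begin{bmatrix}Q_1&Q_2\\Q_3&Q_3\\0&Q_4\end{bmatrix},\quad M^{\rm Bal}_{(c,\mu_4)}:\begin{bmatrix}Q_1&Q_2\\Q_3&Q_1\\0&Q_4\end{bmatrix},\quad M^{\rm Bal}_{(c,\mu_5)}:\begin{bmatrix}Q_1&Q_2\\Q_3&Q_4\\0&Q_5\end{bmatrix},$$ $$M^{\rm Bal}_{(\emptyset,\mu_4)}:\begin{bmatrix}Q_1&Q_2\\Q_2&Q_3\\Q_3&Q_4\end{bmatrix},\quad M^{\rm Bal}_{(\emptyset,\mu_5)}:\begin{bmatrix}Q_1&Q_2\\Q_3&Q_4\\Q_5&Q_1\end{bmatrix},\quad M^{\rm Bal}_{(\emptyset,\mu_6)}:\begin{bmatrix}Q_1&Q_2\\Q_3&Q_4\\Q_5&Q_6\end{bmatrix}.$$ For each $\natural\in\operatorname{ECP}$, $\operatorname{DO}^{\rm Bal}_\natural=G\cdot M^{\rm Bal}_\natural=\{g\varphi\mid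 g\in G,\ \varphi\in M^{\rm Bal}_\natural\}\subseteq\operatorname{BalH}_d$. (Some of these sets may be empty for small $c$.) *)

theory Defs
  imports
    "HOL-Analysis.Cartesian_Space"
    "HOL-Analysis.Determinants"
    "HOL-Algebra.Algebraic_Closure_Type"
    "HOL-Library.Extended_Nat"
    "HOL-Library.Disjoint_Sets"
begin

section \<open>Height of an ideal\<close>

definition prime_height :: "('a, 'b) ring_scheme \<Rightarrow> 'a set \<Rightarrow> enat" where
  "prime_height R P =
     (SUP n \<in> {n. \<exists>C :: nat \<Rightarrow> 'a set.
         (\<forall>i\<le>n. primeideal (C i) R) \<and> (\<forall>i<n. C i \<subset> C (Suc i)) \<and> C n = P}. enat n)"

text \<open>The unit ideal has height \<open>\<infinity>\<close>, the infimum of the empty set.\<close>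

definition ideal_height :: "('a, 'b) ring_scheme \<Rightarrow> 'a set \<Rightarrow> enat" where
  "ideal_height R I = (INF P \<in> {P. primeideal P R \<and> I \<subseteq> P}. prime_height R P)"

section \<open>The graded ring \<open>B = k[x,y]\<close>\<close>

text \<open>
  \<open>B\<close> is represented as \<open>k[x][y]\<close>: the coefficient of \<open>x\<^sup>i y\<^sup>j\<close> in \<open>p\<close> is
  \<open>coeff (coeff p j) i\<close>.
\<close>

type_synonym 'a bipoly = "'a poly poly"

definition const_bipoly :: "'a::field \<Rightarrow> 'a bipoly" where
  "const_bipoly a = [:[:a:]:]"

definition forms :: "nat \<Rightarrow> 'a::field bipoly set" where
  "forms c = {p. \<forall>i j. Polynomial.coeff (Polynomial.coeff p j) i \<noteq> 0 \<longrightarrow> i + j = c}"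

definition scale_bipoly :: "'a::field \<Rightarrow> 'a bipoly \<Rightarrow> 'a bipoly" where
  "scale_bipoly a p = const_bipoly a * p"

global_interpretation bipoly: vector_space "scale_bipoly :: 'a::field \<Rightarrow> _"
proof unfold_locales
  fix a b :: 'a and p :: "'a bipoly"
  have "const_bipoly (a + b) = const_bipoly a + const_bipoly b"
    by (simp add: const_bipoly_def)
  then show "scale_bipoly (a + b) p = scale_bipoly a p + scale_bipoly b p"
    by (simp only: scale_bipoly_def distrib_right)
qed (simp_all add: scale_bipoly_def const_bipoly_def Polynomial.smult_add_right flip: one_pCons)

text \<open>
  Linear independence of the family \<open>Qs\<close>; \<open>distinct\<close> is needed because
  \<open>bipoly.independent\<close> is a property of the underlying set.
\<close>

definition indep_forms :: "nat \<Rightarrow> 'a::field bipoly list \<Rightarrow> bool" where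
  "indep_forms c Qs \<longleftrightarrow> set Qs \<subseteq> forms c \<and> distinct Qs \<and> bipoly.independent (set Qs)"

section \<open>Balanced Hilbert-Burch matrices\<close>

text \<open>The type \<open>'b^2^3\<close> consists of the matrices with 3 rows and 2 columns.\<close>

type_synonym 'a mat32 = "'a bipoly^2^3"

definition minor2 :: "'a::field mat32 \<Rightarrow> 3 \<Rightarrow> 3 \<Rightarrow> 'a bipoly" where
  "minor2 \<phi> i j = det (vector [\<phi> $ i, \<phi> $ j] :: 'a bipoly^2^2)"

definition I2 :: "'a::field mat32 \<Rightarrow> 'a bipoly set" where
  "I2 \<phi> = genideal ring_of_type_algebra {minor2 \<phi> 1 2, minor2 \<phi> 1 3, minor2 \<phi> 2 3}"

text \<open>Here and below \<open>d = 2c\<close> is meant to be even, and \<open>d div 2\<close> is \<open>c\<close>.\<close>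

definition BalH :: "nat \<Rightarrow> 'a::field mat32 set" where
  "BalH d = {\<phi>. (\<forall>i j. \<phi> $ i $ j \<in> forms (d div 2)) \<and>
                 ideal_height ring_of_type_algebra (I2 \<phi>) = 2}"

definition const_mat :: "'a::field^'n^'m \<Rightarrow> 'a bipoly^'n^'m" where
  "const_mat A = (\<chi> i j. const_bipoly (A $ i $ j))"

definition G :: "(('a::field^3^3) \<times> ('a^2^2)) set" where
  "G = {A. invertible A} \<times> {B. invertible B}"

definition act :: "('a::field^3^3) \<times> ('a^2^2) \<Rightarrow> 'a mat32 \<Rightarrow> 'a mat32" where
  "act g \<phi> = const_mat (fst g) ** \<phi> ** const_mat (matrix_inv (snd g))"

text \<open>
  In the constructor names, \<open>Col\<close> stands for the colon and \<open>Com\<close> for the comma; thus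
  \<open>C_Col_C_Com_C\<close> is the symbol ``\<open>c:c,c\<close>''.
\<close>

datatype ECP =
    Mu2
  | C_Col_C_Col_C
  | C_Col_C_Com_C
  | C_Com_C_Com_C
  | C_Col_C
  | C_Com_C
  | C_Mu4
  | C_Mu5
  | Empty_Mu4
  | Empty_Mu5
  | Empty_Mu6

definition rows32 ::
  "'a::field bipoly \<Rightarrow> 'a bipoly \<Rightarrow> 'a bipoly \<Rightarrow> 'a bipoly \<Rightarrow> 'a bipoly \<Rightarrow> 'a bipoly \<Rightarrow> 'a mat32" where
  "rows32 a b c d e f = vector [vector [a, b], vector [c, d], vector [e, f]]"

fun M_Bal :: "nat \<Rightarrow> ECP \<Rightarrow> 'a::field mat32 set" where
  "M_Bal d Mu2 = {\<phi> \<in> BalH d. \<exists>Q1 Q2. indep_forms (d div 2) [Q1, Q2] \<and>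
     \<phi> = rows32 Q1 0
                Q2 Q1
                0  Q2}"
| "M_Bal d C_Col_C_Col_C = {\<phi> \<in> BalH d. \<exists>Q1 Q2 Q3. indep_forms (d div 2) [Q1, Q2, Q3] \<and>
     \<phi> = rows32 Q1 Q2
                Q3 Q1
                0  Q3}"
| "M_Bal d C_Col_C_Com_C = {\<phi> \<in> BalH d. \<exists>Q1 Q2 Q3. indep_forms (d div 2) [Q1, Q2, Q3] \<and>
     \<phi> = rows32 Q1 0
                Q2 Q3
                0  Q2}"
| "M_Bal d C_Com_C_Com_C = {\<phi> \<in> BalH d. \<exists>Q1 Q2 Q3. indep_forms (d div 2) [Q1, Q2, Q3] \<and>
     \<phi> = rows32 Q1 Q1
                Q2 0
                0  Q3}"
| "M_Bal d C_Col_C = {\<phi> \<in> BalH d. \<exists>Q1 Q2 Q3 Q4. indep_forms (d div 2) [Q1, Q2, Q3, Q4] \<and>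
     \<phi> = rows32 Q1 Q2
                Q3 Q4
                0  Q3}"
| "M_Bal d C_Com_C = {\<phi> \<in> BalH d. \<exists>Q1 Q2 Q3 Q4. indep_forms (d div 2) [Q1, Q2, Q3, Q4] \<and>
     \<phi> = rows32 Q1 Q2
                Q3 Q3
                0  Q4}"
| "M_Bal d C_Mu4 = {\<phi> \<in> BalH d. \<exists>Q1 Q2 Q3 Q4. indep_forms (d div 2) [Q1, Q2, Q3, Q4] \<and>
     \<phi> = rows32 Q1 Q2
                Q3 Q1
                0  Q4}"
| "M_Bal d C_Mu5 = {\<phi> \<in> BalH d. \<exists>Q1 Q2 Q3 Q4 Q5. indep_forms (d div 2) [Q1, Q2, Q3, Q4, Q5] \<and>
     \<phi> = rows32 Q1 Q2
                Q3 Q4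
                0  Q5}"
| "M_Bal d Empty_Mu4 = {\<phi> \<in> BalH d. \<exists>Q1 Q2 Q3 Q4. indep_forms (d div 2) [Q1, Q2, Q3, Q4] \<and>
     \<phi> = rows32 Q1 Q2
                Q2 Q3
                Q3 Q4}"
| "M_Bal d Empty_Mu5 = {\<phi> \<in> BalH d. \<exists>Q1 Q2 Q3 Q4 Q5. indep_forms (d div 2) [Q1, Q2, Q3, Q4, Q5] \<and>
     \<phi> = rows32 Q1 Q2
                Q3 Q4
                Q5 Q1}"
| "M_Bal d Empty_Mu6 = {\<phi> \<in> BalH d. \<exists>Q1 Q2 Q3 Q4 Q5 Q6.
     indep_forms (d div 2) [Q1, Q2, Q3, Q4, Q5, Q6] \<and>
     \<phi> = rows32 Q1 Q2
                Q3 Q4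
                Q5 Q6}"

definition DO_Bal :: "nat \<Rightarrow> ECP \<Rightarrow> 'a::field mat32 set" where
  "DO_Bal d s = {act g \<phi> | g \<phi>. g \<in> G \<and> \<phi> \<in> M_Bal d s}"

end

theory Submission
  imports Defs "Berlekamp_Zassenhaus.Unique_Factorization_Poly"
begin

text \<open>
  A matrix \<open>\<phi>\<close> with entries in \<open>B\<^sub>c\<close> is a bilinear map \<open>(u, v) \<mapsto> u\<^sup>T \<phi> v\<close> from \<open>k\<^sup>3 \<times> k\<^sup>2\<close> to
  \<open>B\<^sub>c\<close>, and the group acts by changing the two bases. So the theorem classifies, up to row and
  column operations over \<open>k\<close>, the linear relations that can hold among the six entries. A
  \<^emph>\<open>generalized zero\<close> is a pair of nonzero vectors with \<open>u\<^sup>T \<phi> v = 0\<close>; it can be moved to an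
  entry \<open>0\<close> in the lower left corner.

  Height two enters only through one consequence. The ring \<open>k[x,y]\<close> is factorial, so an ideal
  inside a proper principal ideal lies in a prime ideal of height at most one; hence no form of
  positive degree divides all maximal minors of a balanced Hilbert-Burch matrix
  (\<open>BalH_no_common_factor\<close>). This excludes the degenerate patterns of relations: a zero row, a
  generalized column whose entries are multiples of a single form, and the matrix with rows
  \<open>(a, b)\<close>, \<open>(q, 0)\<close>, \<open>(0, q)\<close>.

  Suppose that there is a generalized zero, so that the rows are \<open>(a, b)\<close>, \<open>(c, d)\<close>, \<open>(0, e)\<close>.
  Then \<open>a\<close> and \<open>c\<close> are independent and \<open>e\<close> is nonzero. Whether \<open>e\<close> lies in the span of \<open>a\<close> and
  \<open>c\<close>, and how far \<open>b\<close> and \<open>d\<close> are from the span of \<open>a, c, e\<close>, decides the normal form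
  (\<open>classified_generalized_zero\<close>). When \<open>b\<close> and \<open>d\<close> both lie in that span, they depend on
  \<open>(a, c)\<close> through a \<open>2 \<times> 2\<close> matrix, and an eigenvector of it is required; it exists because
  quadratic polynomials have roots.

  Without a generalized zero, every generalized column consists of three independent forms. If
  the second column lay in the span of the first one, it would be given by a \<open>3 \<times> 3\<close> matrix, whose
  characteristic polynomial has a root; an eigenvector is a generalized zero, a contradiction.
  The remaining cases, in which one, two or three entries of the second column are independent
  modulo the first, lead to the three types with the symbol \<open>\<emptyset>\<close> (\<open>classified_nozero\<close>); if \<open>b\<close>
  is the only independent entry, an eigenvector of a \<open>2 \<times> 2\<close> matrix shows that one of the other two
  entries of its column must involve \<open>a\<close>.

  The eleven orbit sets are separated by four invariants: the dimension of the span of the entries,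
  the existence of a generalized zero, the existence of two of them in different generalized
  columns, and the existence of a generalized zero with another one infinitely near to it
  (\<open>M_Bal_orbit_type\<close>, \<open>orbit_type_unique\<close>).
\<close>

hide_const (open) Matrix.mat Order.top
no_notation fps_nth (infixl "$" 75)
no_notation Matrix.vec_index (infixl "$" 100)

notation const_bipoly ("\<kappa>")

section \<open>Height one in \<open>k[x,y]\<close>\<close>

lemma ideal_ring_of_type_algebra_iff:
  "ideal P (ring_of_type_algebra :: 'a::comm_ring_1 ring) \<longleftrightarrow>
     0 \<in> P \<and> (\<forall>a\<in>P. \<forall>b\<in>P. a + b \<in> P) \<and> (\<forall>a\<in>P. \<forall>r. r * a \<in> P)"
proof -
  interpret R: cring "ring_of_type_algebra :: 'a ring" ..
  have inv: "\<ominus>\<^bsub>ring_of_type_algebra\<^esub> a = - a" for a :: 'a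
    by (rule R.minus_equality) (auto simp: ring_of_type_algebra_def)
  show ?thesis
  proof
    assume "ideal P (ring_of_type_algebra :: 'a ring)"
    then interpret ideal P "ring_of_type_algebra :: 'a ring" .
    from zero_closed a_closed I_l_closed show "0 \<in> P \<and> (\<forall>a\<in>P. \<forall>b\<in>P. a + b \<in> P) \<and> (\<forall>a\<in>P. \<forall>r. r * a \<in> P)"
      by (auto simp: ring_of_type_algebra_def)
  next
    assume *: "0 \<in> P \<and> (\<forall>a\<in>P. \<forall>b\<in>P. a + b \<in> P) \<and> (\<forall>a\<in>P. \<forall>r. r * a \<in> P)"
    then have "- a \<in> P" if "a \<in> P" for a
      using that by (metis mult_minus1)
    with * show "ideal P (ring_of_type_algebra :: 'a ring)"
      by (intro idealI R.ring_axioms R.add.subgroupI)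
        (auto simp: a_inv_def[symmetric] inv, auto simp: ring_of_type_algebra_def mult.commute)
  qed
qed

lemma primeideal_ring_of_type_algebra_iff:
  "primeideal P (ring_of_type_algebra :: 'a::comm_ring_1 ring) \<longleftrightarrow>
     ideal P (ring_of_type_algebra :: 'a ring) \<and> 1 \<notin> P \<and> (\<forall>a b. a * b \<in> P \<longrightarrow> a \<in> P \<or> b \<in> P)"
proof -
  interpret R: cring "ring_of_type_algebra :: 'a ring" ..
  have c: "carrier ring_of_type_algebra = (UNIV :: 'a set)" "\<one>\<^bsub>ring_of_type_algebra\<^esub> = (1::'a)"
     "a \<otimes>\<^bsub>ring_of_type_algebra\<^esub> b = a * b" for a b :: 'a
    by (simp_all add: ring_of_type_algebra_def)
  show ?thesis
  proof
    assume "primeideal P (ring_of_type_algebra :: 'a ring)"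
    then interpret primeideal P "ring_of_type_algebra :: 'a ring" .
    show "ideal P (ring_of_type_algebra :: 'a ring) \<and> 1 \<notin> P \<and> (\<forall>a b. a * b \<in> P \<longrightarrow> a \<in> P \<or> b \<in> P)"
      using is_ideal I_notcarr I_prime one_imp_carrier by (auto simp: c)
  next
    assume *: "ideal P (ring_of_type_algebra :: 'a ring) \<and> 1 \<notin> P \<and> (\<forall>a b. a * b \<in> P \<longrightarrow> a \<in> P \<or> b \<in> P)"
    then show "primeideal P (ring_of_type_algebra :: 'a ring)"
      by (intro primeidealI R.cring_axioms) (auto simp: c)
  qed
qed

abbreviation multiples :: "'a::comm_ring_1 \<Rightarrow> 'a set" where
  "multiples q \<equiv> {p. q dvd p}"

lemma primeideal_multiples:
  fixes q :: "'a::idom"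
  assumes "q = 0 \<or> prime_elem q"
  shows "primeideal (multiples q) (ring_of_type_algebra :: 'a ring)"
  using assms
  by (auto simp: primeideal_ring_of_type_algebra_iff ideal_ring_of_type_algebra_iff
      prime_elem_dvd_mult_iff dest: prime_elem_not_unit)

text \<open>The lexicographically leading monomial of \<open>p\<close> has this total degree. Unlike the usual total
  degree it is read off directly from the two nested polynomial degrees, and it is equally
  additive and, on nonzero elements, zero only for units.\<close>

definition bipoly_size :: "'a::field bipoly \<Rightarrow> nat" where
  "bipoly_size p = Polynomial.degree p + Polynomial.degree (lead_coeff p)"

lemma bipoly_size_mult:
  assumes "p \<noteq> 0" "q \<noteq> 0"
  shows "bipoly_size (p * q) = bipoly_size p + bipoly_size q"
  using assms by (simp add: bipoly_size_def lead_coeff_mult degree_mult_eq[of p q] degree_mult_eq[of "lead_coeff p" "lead_coeff q"]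
     del: coeff_mult_degree_sum flip: degree_mult_eq[of p q])

lemma bipoly_size_pos:
  assumes "p \<noteq> 0" "\<not> is_unit p"
  shows "bipoly_size p > 0"
proof (rule ccontr)
  assume "\<not> bipoly_size p > 0"
  then have "Polynomial.degree p = 0 \<and> Polynomial.degree (lead_coeff p) = 0"
    unfolding bipoly_size_def neq0_conv[symmetric] not_not add_is_0 .
  then obtain a where "p = [:[:a:]:]"
    by (metis degree_eq_zeroE lead_coeff_pCons(2))
  with assms show False
    by (auto simp: is_unit_const_poly_iff is_unit_triv)
qed

text \<open>A nonzero element \<open>a = q b\<close> of \<open>P\<close> of least size has \<open>b \<notin> P\<close>, because a nonunit \<open>q\<close> has positive
  size; so \<open>q \<in> P\<close> by primality. For prime \<open>q\<close> this says that no prime ideal lies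
  strictly between \<open>0\<close> and \<open>(q)\<close>.\<close>

lemma nonzero_prime_in_multiples:
  fixes q :: "'a::field bipoly"
  assumes P: "primeideal P ring_of_type_algebra" and "P \<subseteq> multiples q"
    and q: "q \<noteq> 0" "\<not> is_unit q" and "a \<in> P" "a \<noteq> 0"
  shows "P = multiples q"
proof -
  have "\<exists>a. a \<in> P \<and> a \<noteq> 0" using assms by blast
  then obtain a where a: "a \<in> P" "a \<noteq> 0"
    and min: "\<And>b. b \<in> P \<Longrightarrow> b \<noteq> 0 \<Longrightarrow> bipoly_size a \<le> bipoly_size b"
    using ex_has_least_nat[of "\<lambda>a. a \<in> P \<and> a \<noteq> 0" _ bipoly_size] by blast
  obtain b where b: "a = q * b"
    using a assms(2) by blast
  then have "b \<noteq> 0" using a by auto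
  then have "bipoly_size b < bipoly_size a"
    using bipoly_size_pos[OF q] q by (simp add: b bipoly_size_mult)
  then have "b \<notin> P" using min[of b] \<open>b \<noteq> 0\<close> by auto
  then have "q \<in> P"
    using P a b by (auto simp: primeideal_ring_of_type_algebra_iff)
  have "multiples q \<subseteq> P"
  proof
    fix p assume "p \<in> multiples q"
    then obtain r where "p = r * q" by (metis dvdE mem_Collect_eq mult.commute)
    with \<open>q \<in> P\<close> P show "p \<in> P"
      by (simp add: primeideal_ring_of_type_algebra_iff ideal_ring_of_type_algebra_iff)
  qed
  with assms(2) show ?thesis by blast
qed

lemma prime_height_multiples_le:
  fixes q :: "'a::field bipoly"
  assumes "q = 0 \<or> \<not> is_unit q"
  shows "prime_height ring_of_type_algebra (multiples q) \<le> 1"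
  unfolding prime_height_def
proof (rule SUP_least)
  fix n
  assume "n \<in> {n. \<exists>C :: nat \<Rightarrow> 'a bipoly set. (\<forall>i\<le>n. primeideal (C i) ring_of_type_algebra) \<and>
      (\<forall>i<n. C i \<subset> C (Suc i)) \<and> C n = multiples q}"
  then obtain C :: "nat \<Rightarrow> 'a bipoly set" where C: "\<And>i. i \<le> n \<Longrightarrow> primeideal (C i) ring_of_type_algebra"
     "\<And>i. i < n \<Longrightarrow> C i \<subset> C (Suc i)" "C n = multiples q" by blast
  have zero: "0 \<in> C i" if "i \<le> n" for i
    using C(1)[OF that] by (simp add: primeideal_ring_of_type_algebra_iff ideal_ring_of_type_algebra_iff)
  show "enat n \<le> 1"
  proof (rule ccontr)
    assume "\<not> enat n \<le> 1"
    then have "n \<ge> 2" by (simp add: one_enat_def)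
    then obtain m where m: "n = Suc (Suc m)" by (metis Suc_diff_Suc add_2_eq_Suc le_add_diff_inverse)
    have "C m \<subset> C (Suc m)" "C (Suc m) \<subset> multiples q"
      using C(2)[of m] C(2)[of "Suc m"] C(3) m by auto
    moreover from this obtain a where "a \<in> C (Suc m)" "a \<notin> C m" by blast
    moreover have "a \<noteq> 0" using zero[of m] m calculation by auto
    moreover have "q \<noteq> 0" using calculation by auto
    ultimately show False
      using nonzero_prime_in_multiples[of "C (Suc m)" q a] C(1)[of "Suc m"] assms m by auto
  qed
qed

text \<open>Factoriality replaces Krull's principal ideal theorem: an irreducible factor of \<open>q\<close> generates a
  prime ideal.\<close>

lemma ideal_height_le_1:
  fixes q :: "'a::field bipoly"
  assumes "q = 0 \<or> \<not> is_unit q" and "I \<subseteq> multiples q"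
  shows "ideal_height ring_of_type_algebra I \<le> 1"
proof -
  obtain r where r: "r dvd q" "r = 0 \<or> prime_elem r"
  proof (cases "q = 0")
    case False
    with assms obtain F where "mset_factors F q"
      using ufd_class.mset_factors_exist by blast
    then obtain r where "irreducible r" "r dvd q"
      using mset_factorsE False by (metis dvd_prod_mset mset_factorsD(1) multiset_nonemptyE mset_factorsD(2))
    have "prime_elem r"
      using \<open>irreducible r\<close> by simp
    show ?thesis
      by (rule that[OF \<open>r dvd q\<close>]) (rule disjI2, fact)
  qed (use that[of 0] in simp)
  then have "r = 0 \<or> \<not> is_unit r" by auto
  then have "prime_height ring_of_type_algebra (multiples r) \<le> 1"
    by (rule prime_height_multiples_le)
  moreover have "ideal_height ring_of_type_algebra I \<le> prime_height ring_of_type_algebra (multiples r)"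
    unfolding ideal_height_def
    using primeideal_multiples[OF r(2)] assms(2) r(1) by (intro INF_lower) (auto intro: dvd_trans)
  ultimately show ?thesis by (rule order_trans[rotated])
qed

section \<open>Linear independence of forms\<close>

lemma const_bipoly_hom:
  "\<kappa> 0 = 0" "\<kappa> 1 = 1"
  "\<kappa> (a + b) = \<kappa> a + \<kappa> b"
  "\<kappa> (a - b) = \<kappa> a - \<kappa> b"
  "\<kappa> (- a) = - \<kappa> a"
  "\<kappa> (a * b) = \<kappa> a * \<kappa> b"
  by (simp_all add: const_bipoly_def flip: one_pCons)

lemma const_bipoly_sum: "\<kappa> (sum f A) = (\<Sum>i\<in>A. \<kappa> (f i))"
  by (induction A rule: infinite_finite_induct) (simp_all add: const_bipoly_hom)

text \<open>Lists rather than sets, since a repeated entry has to count as a relation.\<close>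

definition lin_indep :: "'a::field bipoly list \<Rightarrow> bool" where
  "lin_indep Qs \<longleftrightarrow> distinct Qs \<and> bipoly.independent (set Qs)"

abbreviation bspan :: "'a::field bipoly list \<Rightarrow> 'a bipoly set" where
  "bspan Qs \<equiv> bipoly.span (set Qs)"

lemma indep_forms_iff: "indep_forms c Qs \<longleftrightarrow> set Qs \<subseteq> forms c \<and> lin_indep Qs"
  by (auto simp: indep_forms_def lin_indep_def)

lemma lin_indep_Nil: "lin_indep []"
  by (simp add: lin_indep_def bipoly.independent_empty)

lemma lin_indep_Cons: "lin_indep (Q # Qs) \<longleftrightarrow> Q \<notin> bspan Qs \<and> lin_indep Qs"
  by (auto simp: lin_indep_def bipoly.independent_insert bipoly.span_base)

lemma bspan_Cons: "p \<in> bspan (Q # Qs) \<longleftrightarrow> (\<exists>k. p - \<kappa> k * Q \<in> bspan Qs)"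
  by (simp add: bipoly.span_breakdown_eq scale_bipoly_def)

lemma span_const_mult: "p \<in> bipoly.span S \<Longrightarrow> \<kappa> k * p \<in> bipoly.span S"
  using bipoly.span_scale[of p S k] by (simp add: scale_bipoly_def)

lemmas span_closed = span_const_mult bipoly.span_zero bipoly.span_add bipoly.span_diff bipoly.span_base

lemma dim_bspan: "lin_indep Qs \<Longrightarrow> bipoly.dim (set Qs) = length Qs"
  by (simp add: lin_indep_def bipoly.dim_eq_card_independent distinct_card)

text \<open>Independence is transported along a change of basis by counting: as many vectors as a basis,
  spanning at least the same space.\<close>

lemma lin_indep_exchange:
  assumes "lin_indep Qs" "length Rs = length Qs" "set Qs \<subseteq> bspan Rs"
  shows "lin_indep Rs"
proof -
  have le: "length Rs \<le> card S" if "finite S" "set Rs \<subseteq> bipoly.span S" for S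
  proof -
    have "set Qs \<subseteq> bipoly.span S"
      using assms(3) that(2) bipoly.span_minimal[OF that(2) bipoly.subspace_span] by blast
    then have "card (set Qs) \<le> card S"
      using bipoly.independent_span_bound[of S "set Qs"] that(1) assms(1) by (simp add: lin_indep_def)
    then show ?thesis using assms(1,2) by (simp add: lin_indep_def distinct_card)
  qed
  have "distinct Rs"
    using le[of "set Rs"] card_length[of Rs] by (simp add: bipoly.span_superset card_distinct)
  moreover have "bipoly.independent (set Rs)"
  proof
    assume "bipoly.dependent (set Rs)"
    then obtain r where r: "r \<in> set Rs" "r \<in> bipoly.span (set Rs - {r})"
      unfolding bipoly.dependent_def by blast
    then have "set Rs \<subseteq> bipoly.span (set Rs - {r})"
      by (metis bipoly.span_redundant bipoly.span_superset insert_Diff)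
    from le[OF _ this] r(1) have "length Rs \<le> card (set Rs) - 1" by simp
    moreover have "card (set Rs) > 0" using r(1) by (auto simp: card_gt_0_iff)
    ultimately show False using card_length[of Rs] by linarith
  qed
  ultimately show ?thesis by (simp add: lin_indep_def)
qed

text \<open>A combination given by its list of coefficients, so that comparing coefficients is an equality
  of lists.\<close>

definition lincomb :: "'a::field list \<Rightarrow> 'a bipoly list \<Rightarrow> 'a bipoly" where
  "lincomb ks Qs = (\<Sum>(k, Q)\<leftarrow>zip ks Qs. \<kappa> k * Q)"

lemma lincomb_simps:
  "lincomb [] Qs = 0" "lincomb (k # ks) (Q # Qs) = \<kappa> k * Q + lincomb ks Qs"
  by (simp_all add: lincomb_def)

lemma lincomb_in_bspan: "lincomb ks Qs \<in> bspan Qs"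
proof (induction ks Qs rule: list_induct2')
  case (4 k ks Q Qs)
  then have "lincomb ks Qs \<in> bspan (Q # Qs)"
    using bipoly.span_mono[of "set Qs" "set (Q # Qs)"] by auto
  then show ?case
    by (simp only: lincomb_simps span_closed list.set_intros)
qed (simp_all add: lincomb_def bipoly.span_zero)

lemma lin_indep_coeffs_zero:
  "lin_indep Qs \<Longrightarrow> length ks = length Qs \<Longrightarrow> lincomb ks Qs = 0 \<Longrightarrow> \<forall>k\<in>set ks. k = 0"
proof (induction Qs arbitrary: ks)
  case (Cons Q Qs)
  then obtain l ls where ks: "ks = l # ls" "length ls = length Qs"
    by (cases ks) auto
  have "l = 0"
  proof (rule ccontr)
    assume "l \<noteq> 0"
    have "\<kappa> l * Q = - lincomb ls Qs"
      using Cons.prems(3) ks by (simp add: lincomb_simps eq_neg_iff_add_eq_0)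
    then have "\<kappa> (1 / l) * (\<kappa> l * Q) = \<kappa> (- 1 / l) * lincomb ls Qs"
      by (simp add: const_bipoly_hom)
    then have "Q = \<kappa> (- 1 / l) * lincomb ls Qs"
      using \<open>l \<noteq> 0\<close> by (simp flip: mult.assoc const_bipoly_hom(6) add: const_bipoly_hom(2))
    then have "Q \<in> bspan Qs"
      by (simp only: span_closed lincomb_in_bspan)
    then show False using Cons.prems(1) by (simp add: lin_indep_Cons)
  qed
  then show ?case
    using Cons ks by (auto simp: lincomb_simps const_bipoly_hom lin_indep_Cons)
qed simp

lemma const_bipoly_cancel:
  assumes "k \<noteq> 0"
  shows "\<kappa> (1 / k) * (\<kappa> k * p) = p" "\<kappa> k * (\<kappa> (1 / k) * p) = p"
  using assms by (simp_all flip: mult.assoc const_bipoly_hom(6) add: const_bipoly_hom(2))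

lemma lin_indep_perm:
  "lin_indep Qs \<Longrightarrow> set Rs = set Qs \<Longrightarrow> length Rs = length Qs \<Longrightarrow> lin_indep Rs"
  by (rule lin_indep_exchange[of Qs]) (auto intro: bipoly.span_base)

lemma lin_indep_add:
  "lin_indep (a # Qs) \<Longrightarrow> p \<in> bspan Qs \<Longrightarrow> lin_indep ((a + p) # Qs)"
  by (simp add: lin_indep_Cons bipoly.span_add_eq2)

lemma lin_indep_diff:
  "lin_indep (a # Qs) \<Longrightarrow> p \<in> bspan Qs \<Longrightarrow> lin_indep ((a - p) # Qs)"
  using lin_indep_add[of a Qs "- p"] bipoly.span_neg[of p "set Qs"] by simp

lemma lin_indep_scale:
  assumes "lin_indep (a # Qs)" "k \<noteq> 0"
  shows "lin_indep (\<kappa> k * a # Qs)"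
  using assms span_const_mult[of "\<kappa> k * a" "set Qs" "1 / k"]
  by (auto simp: lin_indep_Cons const_bipoly_cancel)

lemma lin_indep_mix:
  assumes "lin_indep (a # c # Qs)" "p * s - q * r \<noteq> 0"
  shows "lin_indep ((\<kappa> p * a + \<kappa> q * c) # (\<kappa> r * a + \<kappa> s * c) # Qs)" (is "lin_indep ?Rs")
proof (rule lin_indep_exchange[OF assms(1)])
  define k where "k = 1 / (p * s - q * r)"
  have 1: "k * (p * s - q * r) = 1" using assms(2) by (simp add: k_def)
  let ?a = "\<kappa> p * a + \<kappa> q * c" and ?c = "\<kappa> r * a + \<kappa> s * c"
  have "\<kappa> k * (\<kappa> s * ?a - \<kappa> q * ?c) = \<kappa> (k * (p * s - q * r)) * a"
       "\<kappa> k * (\<kappa> p * ?c - \<kappa> r * ?a) = \<kappa> (k * (p * s - q * r)) * c"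
    by (simp_all add: const_bipoly_hom algebra_simps)
  then have *: "a = \<kappa> k * (\<kappa> s * ?a - \<kappa> q * ?c)" "c = \<kappa> k * (\<kappa> p * ?c - \<kappa> r * ?a)"
    by (simp_all add: 1 const_bipoly_hom(2))
  have mem: "?a \<in> bspan ?Rs" "?c \<in> bspan ?Rs" by (simp_all add: bipoly.span_base)
  have "a \<in> bspan ?Rs" by (subst *(1)) (intro span_closed mem)
  moreover have "c \<in> bspan ?Rs" by (subst *(2)) (intro span_closed mem)
  ultimately show "set (a # c # Qs) \<subseteq> bspan ?Rs" by (auto intro: bipoly.span_base)
qed simp

lemma bspan_1E: assumes "p \<in> bspan [a]" obtains k where "p = \<kappa> k * a"
proof -
  obtain k where "p - \<kappa> k * a \<in> bspan []" using assms unfolding bspan_Cons by blast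
  then show ?thesis using that[of k] by simp
qed

lemma bspan_2E: assumes "p \<in> bspan [a, b]" obtains k l where "p = \<kappa> k * a + \<kappa> l * b"
proof -
  obtain k where "p - \<kappa> k * a \<in> bspan [b]" using assms unfolding bspan_Cons by blast
  then obtain l where "p - \<kappa> k * a = \<kappa> l * b" by (rule bspan_1E)
  then show ?thesis using that[of k l] by (simp add: algebra_simps)
qed

lemma bspan_3E: assumes "p \<in> bspan [a, b, c]" obtains k l m where "p = \<kappa> k * a + \<kappa> l * b + \<kappa> m * c"
proof -
  obtain k where "p - \<kappa> k * a \<in> bspan [b, c]" using assms unfolding bspan_Cons by blast
  then obtain l m where "p - \<kappa> k * a = \<kappa> l * b + \<kappa> m * c" by (rule bspan_2E)
  then show ?thesis using that[of k l m] by (simp add: algebra_simps)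
qed

section \<open>Orbits and balanced Hilbert-Burch matrices\<close>

lemma matrix_inv_inverse:
  assumes "invertible A"
  shows "A ** matrix_inv A = mat 1" "matrix_inv A ** A = mat 1"
  using someI_ex[OF assms[unfolded invertible_def]] by (simp_all add: matrix_inv_def)

text \<open>The same relation as membership in a common orbit, with \<open>N\<close> in place of \<open>\<xi>\<^sup>-\<^sup>1\<close>; this spares
  inverting the second factor.\<close>

definition orbit_equiv :: "'a::field mat32 \<Rightarrow> 'a mat32 \<Rightarrow> bool" (infix "\<approx>" 50) where
  "\<phi> \<approx> \<psi> \<longleftrightarrow> (\<exists>A N. invertible A \<and> invertible N \<and> \<psi> = const_mat A ** \<phi> ** const_mat N)"

lemma invertible_matrix_inv:
  fixes A :: "'a::field^'n^'n"
  assumes "invertible A"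
  shows "invertible (matrix_inv A)" "matrix_inv (matrix_inv A) = A"
proof -
  show inv: "invertible (matrix_inv A)"
    using assms matrix_inv_inverse[of A] unfolding invertible_def by blast
  have "matrix_inv (matrix_inv A) = (A ** matrix_inv A) ** matrix_inv (matrix_inv A)"
    using assms by (simp add: matrix_inv_inverse)
  also have "\<dots> = A"
    using matrix_inv_inverse(1)[OF inv] by (simp flip: matrix_mul_assoc)
  finally show "matrix_inv (matrix_inv A) = A" .
qed

lemma DO_Bal_iff: "\<psi> \<in> DO_Bal d s \<longleftrightarrow> (\<exists>\<phi> \<in> M_Bal d s. \<phi> \<approx> \<psi>)"
proof
  assume "\<psi> \<in> DO_Bal d s"
  then show "\<exists>\<phi> \<in> M_Bal d s. \<phi> \<approx> \<psi>"
    unfolding DO_Bal_def G_def orbit_equiv_def act_def using invertible_matrix_inv(1) by fastforce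
next
  assume "\<exists>\<phi> \<in> M_Bal d s. \<phi> \<approx> \<psi>"
  then obtain \<phi> A N where *: "\<phi> \<in> M_Bal d s" "invertible A" "invertible N"
    "\<psi> = const_mat A ** \<phi> ** const_mat N"
    unfolding orbit_equiv_def by blast
  then have "\<psi> = act (A, matrix_inv N) \<phi>" "(A, matrix_inv N) \<in> G"
    by (simp_all add: act_def G_def invertible_matrix_inv)
  then show "\<psi> \<in> DO_Bal d s" unfolding DO_Bal_def using *(1) by blast
qed

lemma const_mat_mult: "const_mat (A ** B) = const_mat A ** const_mat B"
  by (simp add: const_mat_def matrix_matrix_mult_def Finite_Cartesian_Product.vec_eq_iff const_bipoly_sum const_bipoly_hom)

lemma const_mat_1: "const_mat (mat 1) = mat 1"
  by (auto simp: const_mat_def Finite_Cartesian_Product.mat_def Finite_Cartesian_Product.vec_eq_iff const_bipoly_hom)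

lemma orbit_equiv_refl: "\<phi> \<approx> \<phi>"
  unfolding orbit_equiv_def
  by (intro exI[of _ "mat 1"]) (auto simp: const_mat_1 invertible_def)

lemma orbit_equiv_trans [trans]:
  assumes "\<phi> \<approx> \<psi>" "\<psi> \<approx> \<omega>"
  shows "\<phi> \<approx> \<omega>"
proof -
  from assms obtain A N B M where "invertible A" "invertible N" "\<psi> = const_mat A ** \<phi> ** const_mat N"
    and "invertible B" "invertible M" "\<omega> = const_mat B ** \<psi> ** const_mat M"
    unfolding orbit_equiv_def by blast
  then show ?thesis
    unfolding orbit_equiv_def
    by (intro exI[of _ "B ** A"] exI[of _ "N ** M"])
      (simp add: invertible_mult const_mat_mult matrix_mul_assoc)
qed

lemma orbit_equiv_sym:
  assumes "\<phi> \<approx> \<psi>"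
  shows "\<psi> \<approx> \<phi>"
proof -
  from assms obtain A N where *: "invertible A" "invertible N" "\<psi> = const_mat A ** \<phi> ** const_mat N"
    unfolding orbit_equiv_def by blast
  have "const_mat (matrix_inv A) ** \<psi> ** const_mat (matrix_inv N) =
     const_mat (matrix_inv A ** A) ** \<phi> ** const_mat (N ** matrix_inv N)"
    by (simp add: * const_mat_mult matrix_mul_assoc)
  also have "\<dots> = \<phi>"
    using * by (simp add: matrix_inv_inverse const_mat_1)
  finally show ?thesis
    unfolding orbit_equiv_def using * invertible_matrix_inv(1) by metis
qed

lemma minor2_eq: "minor2 \<phi> i j = \<phi> $ i $ 1 * \<phi> $ j $ 2 - \<phi> $ i $ 2 * \<phi> $ j $ 1"
  by (simp add: minor2_def det_2)

lemma minor2_const_left: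
  "minor2 (const_mat A ** \<phi>) i j = (\<Sum>k\<in>UNIV. \<Sum>l\<in>UNIV. \<kappa> (A $ i $ k * A $ j $ l) * minor2 \<phi> k l)"
  by (simp add: minor2_eq matrix_matrix_mult_def const_mat_def sum_product const_bipoly_hom algebra_simps sum_subtractf)
    (rule sum.swap)

lemma minor2_const_right:
  "minor2 (\<phi> ** const_mat N) i j = \<kappa> (Determinants.det N) * minor2 \<phi> i j"
  by (simp add: minor2_eq matrix_matrix_mult_def const_mat_def const_bipoly_hom det_2 sum_2 algebra_simps)

text \<open>The three generating minors may be replaced by all of them, including the zero minors on the
  diagonal and the negated ones below it; the Cauchy-Binet expansion in
  \<open>minor2_const_left\<close> then needs no ordering of the indices.\<close>

lemma I2_subset_iff:
  assumes "ideal P ring_of_type_algebra"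
  shows "I2 \<phi> \<subseteq> P \<longleftrightarrow> (\<forall>i j. minor2 \<phi> i j \<in> P)"
proof -
  interpret R: cring "ring_of_type_algebra :: 'a bipoly ring" ..
  let ?S = "{minor2 \<phi> 1 2, minor2 \<phi> 1 3, minor2 \<phi> 2 3}"
  have c: "S \<subseteq> carrier ring_of_type_algebra" for S :: "'a bipoly set"
    by (simp add: ring_of_type_algebra_def)
  have "I2 \<phi> \<subseteq> P \<longleftrightarrow> ?S \<subseteq> P"
    unfolding I2_def using R.genideal_minimal[OF assms, of ?S] R.genideal_self[OF c, of ?S] by blast
  also have "\<dots> \<longleftrightarrow> (\<forall>i j. minor2 \<phi> i j \<in> P)"
  proof
    assume S: "?S \<subseteq> P"
    have P: "0 \<in> P" "\<And>a. a \<in> P \<Longrightarrow> - 1 * a \<in> P"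
      using assms by (auto simp only: ideal_ring_of_type_algebra_iff)
    have "minor2 \<phi> i i = 0" "minor2 \<phi> j i = - 1 * minor2 \<phi> i j" for i j
      by (simp_all add: minor2_eq)
    then show "\<forall>i j. minor2 \<phi> i j \<in> P"
      using S P unfolding forall_3 by (metis insert_subset)
  qed auto
  finally show ?thesis .
qed

lemma ideal_sum:
  assumes "ideal P (ring_of_type_algebra :: 'a::comm_ring_1 ring)" "\<And>i. i \<in> A \<Longrightarrow> f i \<in> P"
  shows "sum f A \<in> P"
  using assms by (induction A rule: infinite_finite_induct) (auto simp: ideal_ring_of_type_algebra_iff)

lemma I2_subset_orbit_equiv:
  assumes "\<phi> \<approx> \<psi>" "ideal P ring_of_type_algebra" "I2 \<phi> \<subseteq> P"
  shows "I2 \<psi> \<subseteq> P"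
proof -
  obtain A N where \<psi>: "\<psi> = const_mat A ** \<phi> ** const_mat N"
    using assms(1) unfolding orbit_equiv_def by blast
  have "r * a \<in> P" if "a \<in> P" for a r
    using that assms(2) by (simp add: ideal_ring_of_type_algebra_iff)
  then have "minor2 \<psi> i j \<in> P" for i j
    unfolding \<psi> minor2_const_right minor2_const_left
    using assms(2,3) by (simp add: ideal_sum I2_subset_iff)
  then show ?thesis by (simp add: I2_subset_iff[OF assms(2)])
qed

lemma forms_closed:
  "0 \<in> forms c" "p \<in> forms c \<Longrightarrow> q \<in> forms c \<Longrightarrow> p + q \<in> forms c"
  "p \<in> forms c \<Longrightarrow> \<kappa> k * p \<in> forms c"
    apply (auto simp: forms_def const_bipoly_def)
  by (metis add.right_neutral)

lemma forms_sum: "(\<And>i. i \<in> A \<Longrightarrow> f i \<in> forms c) \<Longrightarrow> sum f A \<in> forms c"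
  by (induction A rule: infinite_finite_induct) (auto simp: forms_closed)

text \<open>Minors of an equivalent matrix are combinations of the original ones, so both matrices have the
  same primes above their ideals of minors.\<close>

lemma BalH_orbit_equiv:
  assumes "\<phi> \<approx> \<psi>" "\<phi> \<in> BalH d"
  shows "\<psi> \<in> BalH d"
proof -
  obtain A N where \<psi>: "\<psi> = const_mat A ** \<phi> ** const_mat N"
    using assms(1) unfolding orbit_equiv_def by blast
  have "\<psi> $ i $ j \<in> forms (d div 2)" for i j
    using assms(2) unfolding \<psi> BalH_def
    by (auto simp: matrix_matrix_mult_def const_mat_def mult.commute[of _ "\<kappa> _"]
        intro!: forms_sum forms_closed)
  moreover have "I2 \<phi> \<subseteq> P \<longleftrightarrow> I2 \<psi> \<subseteq> P" if "primeideal P ring_of_type_algebra" for P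
    using I2_subset_orbit_equiv[OF assms(1)] I2_subset_orbit_equiv[OF orbit_equiv_sym[OF assms(1)]]
      that primeideal_ring_of_type_algebra_iff by metis
  then have "ideal_height ring_of_type_algebra (I2 \<psi>) = ideal_height ring_of_type_algebra (I2 \<phi>)"
    unfolding ideal_height_def by (metis (no_types, lifting))
  ultimately show ?thesis using assms(2) by (simp add: BalH_def)
qed

lemma BalH_no_common_factor:
  assumes "\<phi> \<in> BalH d" "q = 0 \<or> \<not> is_unit q"
  shows "\<exists>i j. \<not> q dvd minor2 \<phi> i j"
proof (rule ccontr)
  assume "\<not> ?thesis"
  moreover have "ideal (multiples q) ring_of_type_algebra"
    by (auto simp: ideal_ring_of_type_algebra_iff)
  ultimately have "I2 \<phi> \<subseteq> multiples q" by (simp add: I2_subset_iff)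
  from ideal_height_le_1[OF assms(2) this] assms(1) have "(2::enat) \<le> 1" by (simp add: BalH_def)
  then show False by (simp add: one_enat_def numeral_eq_enat)
qed

lemma forms_0: "p \<in> forms 0 \<Longrightarrow> \<exists>a. p = \<kappa> a"
proof -
  assume p: "p \<in> forms 0"
  have "p = \<kappa> (Polynomial.coeff (Polynomial.coeff p 0) 0)"
    unfolding poly_eq_iff
  proof (intro allI)
    fix j i show "Polynomial.coeff (Polynomial.coeff p j) i =
       Polynomial.coeff (Polynomial.coeff (\<kappa> (Polynomial.coeff (Polynomial.coeff p 0) 0)) j) i"
      using p unfolding forms_def const_bipoly_def
      by (cases i; cases j) (force simp: coeff_pCons)+
  qed
  then show ?thesis by blast
qed

text \<open>For constant entries the ideal of minors is zero, of height \<open>0\<close>, or contains a nonzero constant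
  and so lies in no prime ideal.\<close>

lemma BalH_0: "BalH 0 = {}"
proof (rule ccontr)
  assume "BalH 0 \<noteq> ({} :: 'a mat32 set)"
  then obtain \<phi> :: "'a mat32" where \<phi>: "\<phi> \<in> BalH 0" by blast
  then have "\<exists>a. \<phi> $ i $ j = \<kappa> a" for i j
    by (simp add: BalH_def forms_0)
  then obtain e where e: "\<And>i j. \<phi> $ i $ j = \<kappa> (e i j)" by metis
  obtain i j where ij: "minor2 \<phi> i j \<noteq> 0"
    using BalH_no_common_factor[OF \<phi>, of 0] by auto
  obtain a where a: "minor2 \<phi> i j = \<kappa> a"
    unfolding minor2_eq e by (metis const_bipoly_hom(4,6))
  with ij have "a \<noteq> 0" by (auto simp: const_bipoly_hom)
  have "{P. primeideal P ring_of_type_algebra \<and> I2 \<phi> \<subseteq> P} = {}"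
  proof (rule ccontr)
    assume "\<not> ?thesis"
    then obtain P where P: "primeideal P ring_of_type_algebra" "I2 \<phi> \<subseteq> P" by blast
    then have "\<kappa> a \<in> P"
      using a by (metis I2_subset_iff primeideal_ring_of_type_algebra_iff)
    then have "\<kappa> (1 / a) * \<kappa> a \<in> P"
      using P(1) by (simp add: primeideal_ring_of_type_algebra_iff ideal_ring_of_type_algebra_iff)
    then have "1 \<in> P"
      using \<open>a \<noteq> 0\<close> by (simp flip: const_bipoly_hom(6) add: const_bipoly_hom(2))
    then show False using P(1) by (simp add: primeideal_ring_of_type_algebra_iff)
  qed
  then have "ideal_height ring_of_type_algebra (I2 \<phi>) = top"
    unfolding ideal_height_def by (metis (no_types, lifting) INF_empty)
  with \<phi> show False by (simp add: BalH_def top_enat_def)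
qed

lemma origin_not_unit:
  fixes p :: "'a::field bipoly"
  assumes "poly (poly p 0) 0 = 0"
  shows "\<not> is_unit p"
proof
  assume "is_unit p"
  then obtain q where "1 = p * q" by (rule dvdE)
  then have "poly (poly (p * q) 0) 0 = 1" by (metis poly_1)
  with assms show False by simp
qed

lemma forms_origin: "p \<in> forms c \<Longrightarrow> c > 0 \<Longrightarrow> poly (poly p 0) 0 = 0"
  by (auto simp: forms_def poly_0_coeff_0)

text \<open>Vanishing at the origin is an easy test for not being a unit; forms of positive degree and
  their combinations with coefficients in \<open>k[x,y]\<close> pass it.\<close>

lemma BalH_no_common_zero:
  assumes "rows32 a b c d e f \<in> BalH n" "poly (poly q 0) 0 = 0"
    "q dvd a * d - b * c" "q dvd a * f - b * e" "q dvd c * f - d * e"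
  shows False
proof -
  let ?\<phi> = "rows32 a b c d e f"
  have "q dvd minor2 ?\<phi> 1 2" "q dvd minor2 ?\<phi> 1 3" "q dvd minor2 ?\<phi> 2 3"
    using assms(3-5) by (simp_all add: minor2_eq rows32_def)
  moreover have "minor2 ?\<phi> i i = 0" "minor2 ?\<phi> j i = - minor2 ?\<phi> i j" for i j
      by (simp_all add: minor2_eq)
  ultimately have "\<forall>i j. q dvd minor2 ?\<phi> i j"
    unfolding forall_3 by (metis dvd_0_right dvd_minus_iff)
  then show False using BalH_no_common_factor[OF assms(1)] origin_not_unit[OF assms(2)] by blast
qed

text \<open>Every elimination step below is composed of instances of this lemma and the next one.\<close>

lemma row_operation:
  fixes p1 p2 p3 q1 q2 q3 r1 r2 r3 :: "'a::field"
  assumes "Determinants.det (vector [vector [p1, p2, p3], vector [q1, q2, q3], vector [r1, r2, r3]] :: 'a^3^3) \<noteq> 0"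
  shows "rows32 a b c d e f \<approx>
    rows32 (\<kappa> p1 * a + \<kappa> p2 * c + \<kappa> p3 * e)
           (\<kappa> p1 * b + \<kappa> p2 * d + \<kappa> p3 * f)
           (\<kappa> q1 * a + \<kappa> q2 * c + \<kappa> q3 * e)
           (\<kappa> q1 * b + \<kappa> q2 * d + \<kappa> q3 * f)
           (\<kappa> r1 * a + \<kappa> r2 * c + \<kappa> r3 * e)
           (\<kappa> r1 * b + \<kappa> r2 * d + \<kappa> r3 * f)"
proof -
  let ?A = "vector [vector [p1,p2,p3], vector [q1,q2,q3], vector [r1,r2,r3]] :: 'a^3^3"
  have "invertible ?A" using assms by (simp add: invertible_det_nz)
  moreover have "invertible (mat 1 :: 'a^2^2)" by (auto simp: invertible_def)
  ultimately show ?thesis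
    unfolding orbit_equiv_def
    by (intro exI[of _ ?A] exI[of _ "mat 1"])
      (simp add: const_mat_1, simp add: rows32_def Finite_Cartesian_Product.vec_eq_iff forall_3 forall_2 matrix_matrix_mult_def sum_3 const_mat_def)
qed

lemma column_operation:
  fixes p1 p2 q1 q2 :: "'a::field"
  assumes "Determinants.det (vector [vector [p1, p2], vector [q1, q2]] :: 'a^2^2) \<noteq> 0"
  shows "rows32 a b c d e f \<approx>
    rows32 (\<kappa> p1 * a + \<kappa> p2 * b) (\<kappa> q1 * a + \<kappa> q2 * b)
           (\<kappa> p1 * c + \<kappa> p2 * d) (\<kappa> q1 * c + \<kappa> q2 * d)
           (\<kappa> p1 * e + \<kappa> p2 * f) (\<kappa> q1 * e + \<kappa> q2 * f)"
proof -
  let ?N = "vector [vector [p1,q1], vector [p2,q2]] :: 'a^2^2"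
  have "Determinants.det ?N \<noteq> 0"
    using assms by (simp add: det_2 mult.commute)
  then have "invertible ?N" by (simp add: invertible_det_nz)
  moreover have "invertible (mat 1 :: 'a^3^3)" by (auto simp: invertible_def)
  ultimately show ?thesis
    unfolding orbit_equiv_def
    by (intro exI[of _ "mat 1"] exI[of _ ?N])
      (simp add: const_mat_1, simp add: rows32_def Finite_Cartesian_Product.vec_eq_iff forall_3 forall_2 matrix_matrix_mult_def sum_2 const_mat_def mult.commute)
qed

lemma rows32_exhaust: "\<phi> = rows32 (\<phi>$1$1) (\<phi>$1$2) (\<phi>$2$1) (\<phi>$2$2) (\<phi>$3$1) (\<phi>$3$2)"
  by (simp add: rows32_def Finite_Cartesian_Product.vec_eq_iff forall_3 forall_2)

text \<open>These equations evaluate an instance of \<open>row_operation\<close> or \<open>column_operation\<close> with concrete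
  coefficients.\<close>

lemmas elementary_simps = det_2 det_3 const_bipoly_hom

section \<open>Reaching a normal form from a generalized zero\<close>

definition classified :: "nat \<Rightarrow> 'a::field mat32 \<Rightarrow> bool" where
  "classified n \<phi> \<longleftrightarrow> (\<exists>s. \<phi> \<in> DO_Bal n s)"

text \<open>One elimination step: the goal may be moved along the orbit.\<close>

lemma classified_reduce:
  assumes "\<phi> \<in> BalH n" "\<phi> \<approx> \<psi>" "\<psi> \<in> BalH n \<Longrightarrow> classified n \<psi>"
  shows "classified n \<phi>"
  using assms BalH_orbit_equiv orbit_equiv_sym orbit_equiv_trans
  unfolding classified_def DO_Bal_iff by meson

lemma BalH_entries:
  assumes "rows32 a b c d e f \<in> BalH n"
  shows "{a, b, c, d, e, f} \<subseteq> forms (n div 2)"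
  using assms by (auto simp: BalH_def rows32_def forall_3 forall_2)

lemma rows32_inject:
  "rows32 a b c d e f = rows32 a' b' c' d' e' f' \<longleftrightarrow>
     a = a' \<and> b = b' \<and> c = c' \<and> d = d' \<and> e = e' \<and> f = f'"
  by (simp add: rows32_def Finite_Cartesian_Product.vec_eq_iff forall_3 forall_2)

lemma indep_formsI:
  "rows32 a b c d e f \<in> BalH n \<Longrightarrow> lin_indep Qs \<Longrightarrow> set Qs \<subseteq> {a, b, c, d, e, f} \<Longrightarrow>
     indep_forms (n div 2) Qs"
  using BalH_entries by (fastforce simp: indep_forms_iff)

lemma classifiedI: "\<phi> \<in> M_Bal n s \<Longrightarrow> classified n \<phi>"
  unfolding classified_def DO_Bal_iff using orbit_equiv_refl by blast

lemma classified_normal_forms: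
  "rows32 a 0 b a 0 b \<in> BalH n \<Longrightarrow> lin_indep [a, b] \<Longrightarrow> classified n (rows32 a 0 b a 0 b)"
  "rows32 a b c a 0 c \<in> BalH n \<Longrightarrow> lin_indep [a, b, c] \<Longrightarrow> classified n (rows32 a b c a 0 c)"
  "rows32 a 0 b c 0 b \<in> BalH n \<Longrightarrow> lin_indep [a, b, c] \<Longrightarrow> classified n (rows32 a 0 b c 0 b)"
  "rows32 a a b 0 0 c \<in> BalH n \<Longrightarrow> lin_indep [a, b, c] \<Longrightarrow> classified n (rows32 a a b 0 0 c)"
  "rows32 a b c d 0 c \<in> BalH n \<Longrightarrow> lin_indep [a, b, c, d] \<Longrightarrow> classified n (rows32 a b c d 0 c)"
  "rows32 a b c c 0 d \<in> BalH n \<Longrightarrow> lin_indep [a, b, c, d] \<Longrightarrow> classified n (rows32 a b c c 0 d)"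
  "rows32 a b c a 0 d \<in> BalH n \<Longrightarrow> lin_indep [a, b, c, d] \<Longrightarrow> classified n (rows32 a b c a 0 d)"
  "rows32 a b c d 0 e \<in> BalH n \<Longrightarrow> lin_indep [a, b, c, d, e] \<Longrightarrow> classified n (rows32 a b c d 0 e)"
  "rows32 a b b c c d \<in> BalH n \<Longrightarrow> lin_indep [a, b, c, d] \<Longrightarrow> classified n (rows32 a b b c c d)"
  "rows32 a b c d e a \<in> BalH n \<Longrightarrow> lin_indep [a, b, c, d, e] \<Longrightarrow> classified n (rows32 a b c d e a)"
  "rows32 a b c d e f \<in> BalH n \<Longrightarrow> lin_indep [a, b, c, d, e, f] \<Longrightarrow> classified n (rows32 a b c d e f)"
  subgoal by (rule classifiedI[where s = Mu2]) (simp add: rows32_inject indep_formsI)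
  subgoal by (rule classifiedI[where s = C_Col_C_Col_C]) (simp add: rows32_inject indep_formsI)
  subgoal by (rule classifiedI[where s = C_Col_C_Com_C]) (simp add: rows32_inject indep_formsI)
  subgoal by (rule classifiedI[where s = C_Com_C_Com_C]) (simp add: rows32_inject indep_formsI)
  subgoal by (rule classifiedI[where s = C_Col_C]) (simp add: rows32_inject indep_formsI)
  subgoal by (rule classifiedI[where s = C_Com_C]) (simp add: rows32_inject indep_formsI)
  subgoal by (rule classifiedI[where s = C_Mu4]) (simp add: rows32_inject indep_formsI)
  subgoal by (rule classifiedI[where s = C_Mu5]) (simp add: rows32_inject indep_formsI)
  subgoal by (rule classifiedI[where s = Empty_Mu4]) (simp add: rows32_inject indep_formsI)
  subgoal by (rule classifiedI[where s = Empty_Mu5]) (simp add: rows32_inject indep_formsI)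
  subgoal by (rule classifiedI[where s = Empty_Mu6]) (simp add: rows32_inject indep_formsI)
  done

text \<open>Dependent \<open>a\<close> and \<open>c\<close> are multiples of a single form, which then divides all minors.\<close>

lemma indep_first_column:
  assumes B: "rows32 a b c d 0 e \<in> BalH n" and n: "n div 2 > 0"
  shows "lin_indep [a, c]"
proof -
  have "a \<in> forms (n div 2)" "c \<in> forms (n div 2)"
    using BalH_entries[OF B] by auto
  then have 0: "poly (poly a 0) 0 = 0" "poly (poly c 0) 0 = 0"
    using forms_origin n by auto
  have "c \<noteq> 0"
    using BalH_no_common_zero[OF B 0(1)] by auto
  moreover have "a \<notin> bspan [c]"
  proof
    assume "a \<in> bspan [c]"
    then obtain k where "a = \<kappa> k * c" by (rule bspan_1E)
    then have "c dvd a * d - b * c" "c dvd a * e"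
      by simp_all
    then show False using BalH_no_common_zero[OF B 0(2)] by simp
  qed
  ultimately show ?thesis by (simp add: lin_indep_Cons lin_indep_Nil)
qed

lemma nonzero_corner:
  assumes B: "rows32 a b c d 0 e \<in> BalH n" and n: "n div 2 > 0"
  shows "e \<noteq> 0"
proof
  assume "e = 0"
  have "poly (poly a 0) 0 = 0" "poly (poly b 0) 0 = 0"
    using BalH_entries[OF B] forms_origin[OF _ n] by auto
  then have "poly (poly (a * d - b * c) 0) 0 = 0" by simp
  with BalH_no_common_zero[OF B this] \<open>e = 0\<close> show False by simp
qed

text \<open>The case in which \<open>e\<close> lies in the span of \<open>a\<close> and \<open>c\<close>, normalized to \<open>e = c = q\<close>. The types
  \<open>c:c\<close>, \<open>c:c,c\<close>, \<open>c:c:c\<close> and \<open>\<mu>\<^sub>2\<close> arise here, according to which of \<open>d\<close> and \<open>b\<close> can be reduced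
  modulo the remaining entries.\<close>

lemma classified_double_zero:
  assumes B: "rows32 a b q d 0 q \<in> BalH n" and n: "n div 2 > 0" and ind: "lin_indep [a, q]"
  shows "classified n (rows32 a b q d 0 q)"
proof (cases "d \<in> bspan [a, q]")
  case False
  then have ind3: "lin_indep [d, a, q]" using ind by (simp add: lin_indep_Cons)
  show ?thesis
  proof (cases "b \<in> bspan [d, a, q]")
    case False
    then have "lin_indep [b, d, a, q]" using ind3 by (simp add: lin_indep_Cons)
    then have "lin_indep [a, b, q, d]" by (rule lin_indep_perm) auto
    with B show ?thesis by (rule classified_normal_forms)
  next
    case True
    then obtain k l m where b: "b = \<kappa> k * d + \<kappa> l * a + \<kappa> m * q" by (rule bspan_3E)
    define a' d' where "a' = a - \<kappa> k * q" and "d' = d - \<kappa> l * q"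
    have "rows32 a b q d 0 q \<approx> rows32 a (b - \<kappa> l * a) q d' 0 q"
      using column_operation[of 1 0 "- l" 1 a b q d 0 q] by (simp add: elementary_simps d'_def)
    also have "\<dots> \<approx> rows32 a' 0 q d' 0 q"
      using row_operation[of 1 "- k" "- (m + k * l)" 0 1 0 0 0 1 a "b - \<kappa> l * a" q d' 0 q]
      by (simp add: elementary_simps b a'_def d'_def algebra_simps)
    finally show ?thesis
    proof (rule classified_reduce[OF B])
      have "lin_indep [d', a, q]"
        unfolding d'_def using ind3 by (intro lin_indep_diff) (simp_all add: span_closed)
      then have "lin_indep [a, d', q]" by (rule lin_indep_perm) auto
      then have "lin_indep [a', d', q]"
        unfolding a'_def by (intro lin_indep_diff) (simp_all add: span_closed)
      then have "lin_indep [a', q, d']" by (rule lin_indep_perm) auto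
      then show "rows32 a' 0 q d' 0 q \<in> BalH n \<Longrightarrow> classified n (rows32 a' 0 q d' 0 q)"
        by (intro classified_normal_forms)
    qed
  qed
next
  case True
  then obtain k l where d: "d = \<kappa> k * a + \<kappa> l * q" by (rule bspan_2E)
  \<comment> \<open>Otherwise the rows could be brought to \<open>(a, b)\<close>, \<open>(q, 0)\<close>, \<open>(0, q)\<close>, with all minors divisible
    by \<open>q\<close>.\<close>
  have "k \<noteq> 0"
  proof
    assume "k = 0"
    have 0: "poly (poly q 0) 0 = 0" using BalH_entries[OF B] forms_origin[OF _ n] by auto
    have "a * d - b * q = q * (\<kappa> l * a - b)"
      by (simp add: d \<open>k = 0\<close> const_bipoly_hom algebra_simps)
    then show False using BalH_no_common_zero[OF B 0] by simp
  qed
  define a' b' where "a' = \<kappa> k * a" and "b' = \<kappa> k * b"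
  have eq: "rows32 a b q d 0 q \<approx> rows32 a' b' q a' 0 q"
    using row_operation[of k 0 0 0 1 "- l" 0 0 1 a b q d 0 q] \<open>k \<noteq> 0\<close>
    by (simp add: elementary_simps d a'_def b'_def)
  have ind': "lin_indep [a', q]"
    using ind \<open>k \<noteq> 0\<close> unfolding a'_def by (rule lin_indep_scale)
  show ?thesis
  proof (rule classified_reduce[OF B eq])
    assume B': "rows32 a' b' q a' 0 q \<in> BalH n"
    show "classified n (rows32 a' b' q a' 0 q)"
    proof (cases "b' \<in> bspan [a', q]")
      case False
      then have "lin_indep [b', a', q]" using ind' by (simp add: lin_indep_Cons)
      then have "lin_indep [a', b', q]" by (rule lin_indep_perm) auto
      with B' show ?thesis by (rule classified_normal_forms)
    next
      case True
      then obtain r s where b': "b' = \<kappa> r * a' + \<kappa> s * q" by (rule bspan_2E)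
      define a'' where "a'' = a' - \<kappa> r * q"
      have eq: "rows32 a' b' q a' 0 q \<approx> rows32 a'' 0 q a'' 0 q"
        using row_operation[of 1 "- r" "- s" 0 1 "- r" 0 0 1 a' b' q a' 0 q]
        by (simp add: elementary_simps b' a''_def)
      have "lin_indep [a'', q]"
        unfolding a''_def using ind' by (intro lin_indep_diff) (simp_all add: span_closed)
      then show ?thesis
        by (intro classified_reduce[OF B' eq] classified_normal_forms)
    qed
  qed
qed

lemma singular_left_kernel:
  fixes A :: "'a::field^'n^'n"
  assumes "Determinants.det A = 0"
  obtains w where "w \<noteq> 0" "w v* A = 0"
proof -
  have "\<not> (\<exists>B. A ** B = mat 1)"
    using assms by (metis det_I det_mul mult_zero_left zero_neq_one)
  then obtain c i where "(\<Sum>j\<in>UNIV. c j *s Finite_Cartesian_Product.row j A) = 0" "c i \<noteq> 0"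
    unfolding matrix_right_invertible_independent_rows by blast
  then show ?thesis
    by (intro that[of "vec_lambda c"])
      (auto simp: Finite_Cartesian_Product.vec_eq_iff vector_matrix_mult_def
        Finite_Cartesian_Product.row_def mult.commute)
qed

text \<open>An eigenvalue is available because the characteristic polynomial is quadratic.\<close>

lemma left_eigenvector2:
  fixes p q r s :: "'a::field"
  assumes roots: "\<And>f :: 'a poly. Polynomial.degree f = 2 \<Longrightarrow> \<exists>x. poly f x = 0"
  obtains u v l where "u \<noteq> 0 \<or> v \<noteq> 0" "u * p + v * r = l * u" "u * q + v * s = l * v"
proof -
  obtain l where l: "poly [:p * s - q * r, - (p + s), 1:] l = 0"
    using roots[of "[:p * s - q * r, - (p + s), 1:]"] by auto
  let ?A = "vector [vector [p - l, q], vector [r, s - l]] :: 'a^2^2"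
  have "Determinants.det ?A = 0" using l by (simp add: det_2 algebra_simps)
  then obtain w where "w \<noteq> 0" "w v* ?A = 0" by (rule singular_left_kernel)
  then show ?thesis
    by (intro that[of "w $ 1" "w $ 2" l])
      (auto simp: Finite_Cartesian_Product.vec_eq_iff forall_2 vector_matrix_mult_def sum_2 algebra_simps)
qed

text \<open>The characteristic polynomial is written with its explicit coefficients: the sum of the
  principal \<open>2 \<times> 2\<close> minors is its linear coefficient.\<close>

lemma left_eigenvector3:
  fixes p1 p2 p3 q1 q2 q3 r1 r2 r3 :: "'a::field"
  assumes roots: "\<And>f :: 'a poly. Polynomial.degree f = 3 \<Longrightarrow> \<exists>x. poly f x = 0"
  obtains u v w l where "u \<noteq> 0 \<or> v \<noteq> 0 \<or> w \<noteq> 0" "u * p1 + v * q1 + w * r1 = l * u"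
     "u * p2 + v * q2 + w * r2 = l * v" "u * p3 + v * q3 + w * r3 = l * w"
proof -
  let ?f = "[:- Determinants.det (vector [vector [p1, p2, p3], vector [q1, q2, q3], vector [r1, r2, r3]] :: 'a^3^3),
     p1 * q2 - p2 * q1 + p1 * r3 - p3 * r1 + q2 * r3 - q3 * r2, - (p1 + q2 + r3), 1:]"
  obtain l where l: "poly ?f l = 0"
    using roots[of ?f] by auto
  let ?A = "vector [vector [p1 - l, p2, p3], vector [q1, q2 - l, q3], vector [r1, r2, r3 - l]] :: 'a^3^3"
  have "Determinants.det ?A = - poly ?f l" by (simp add: det_3 algebra_simps)
  then have "Determinants.det ?A = 0" using l by simp
  then obtain w where "w \<noteq> 0" "w v* ?A = 0" by (rule singular_left_kernel)
  then show ?thesis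
    by (intro that[of "w $ 1" "w $ 2" "w $ 3" l])
      (auto simp: Finite_Cartesian_Product.vec_eq_iff forall_3 vector_matrix_mult_def sum_3 algebra_simps)
qed

lemma complete_to_basis2:
  fixes s t :: "'a::field"
  assumes "s \<noteq> 0 \<or> t \<noteq> 0"
  obtains p q where "p * t - q * s \<noteq> 0"
  using assms that[of 1 0] that[of 0 1] by auto

text \<open>Write \<open>b = k a + l c\<close>. If \<open>k \<noteq> 0\<close>, then \<open>b\<close> can replace \<open>a\<close>, which gives the type \<open>c,c,c\<close>. If
  \<open>k = 0\<close>, then \<open>b\<close> is a nonzero multiple of \<open>c\<close>, and exchanging the columns gives the type
  \<open>c:c,c\<close>.\<close>

lemma classified_triangular_top:
  assumes B: "rows32 a b c 0 0 e \<in> BalH n" and n: "n div 2 > 0" and ind: "lin_indep [a, c, e]"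
    and b: "b \<in> bspan [a, c]"
  shows "classified n (rows32 a b c 0 0 e)"
proof -
  obtain k l where b: "b = \<kappa> k * a + \<kappa> l * c" using b by (rule bspan_2E)
  show ?thesis
  proof (cases "k = 0")
    case False
    define a' where "a' = a + \<kappa> (l / k) * c"
    have *: "\<kappa> (1 / k) * b = a'"
      using False by (simp add: b a'_def distrib_left const_bipoly_cancel)
         (simp flip: mult.assoc const_bipoly_hom(6))
    have "rows32 a b c 0 0 e \<approx> rows32 a a' c 0 0 (\<kappa> (1 / k) * e)"
      using column_operation[of 1 0 0 "1 / k" a b c 0 0 e] False * by (simp add: elementary_simps)
    also have "\<dots> \<approx> rows32 a' a' c 0 0 (\<kappa> (1 / k) * e)"
      using row_operation[of 1 "l / k" 0 0 1 0 0 0 1 a a' c 0 0 "\<kappa> (1 / k) * e"]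
      by (simp add: elementary_simps a'_def)
    finally show ?thesis
    proof (rule classified_reduce[OF B])
      have "lin_indep [a', c, e]"
        unfolding a'_def using ind by (intro lin_indep_add) (simp_all add: span_closed)
      then have "lin_indep [e, a', c]" by (rule lin_indep_perm) auto
      then have "lin_indep [\<kappa> (1 / k) * e, a', c]" using False by (intro lin_indep_scale) auto
      then have "lin_indep [a', c, \<kappa> (1 / k) * e]" by (rule lin_indep_perm) auto
      then show "rows32 a' a' c 0 0 (\<kappa> (1 / k) * e) \<in> BalH n \<Longrightarrow>
          classified n (rows32 a' a' c 0 0 (\<kappa> (1 / k) * e))"
        by (intro classified_normal_forms)
    qed
  next
    case True
    then have b': "b = \<kappa> l * c" by (simp add: b const_bipoly_hom)
    have "l \<noteq> 0"
    proof
      assume "l = 0"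
      have 0: "poly (poly e 0) 0 = 0" using BalH_entries[OF B] forms_origin[OF _ n] by auto
      from BalH_no_common_zero[OF B this] show False
        by (simp add: b' \<open>l = 0\<close> const_bipoly_hom)
    qed
    have "rows32 a b c 0 0 e \<approx> rows32 b a 0 c e 0"
      using column_operation[of 0 1 1 0 a b c 0 0 e] by (simp add: elementary_simps)
    also have "\<dots> \<approx> rows32 e 0 b a 0 b"
      using row_operation[of 0 0 1 1 0 0 0 l 0 b a 0 c e 0] \<open>l \<noteq> 0\<close>
      by (simp add: elementary_simps) (simp add: b')
    finally show ?thesis
    proof (rule classified_reduce[OF B])
      have "lin_indep [c, a, e]" by (rule lin_indep_perm[OF ind]) auto
      then have "lin_indep [b, a, e]" unfolding b' using \<open>l \<noteq> 0\<close> by (rule lin_indep_scale)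
      then have "lin_indep [e, b, a]" by (rule lin_indep_perm) auto
      then show "rows32 e 0 b a 0 b \<in> BalH n \<Longrightarrow> classified n (rows32 e 0 b a 0 b)"
        by (intro classified_normal_forms)
    qed
  qed
qed

text \<open>After clearing \<open>e\<close>, the entries \<open>b\<close> and \<open>d\<close> are given by a \<open>2 \<times> 2\<close> matrix acting on \<open>(a, c)\<close>. Row
  operations conjugate this matrix and column operations add scalars to it. A left eigenvector,
  taken as second row, makes the second row proportional to \<open>(c, 0)\<close>.\<close>

lemma classified_dim3:
  fixes a b c d e :: "'a::field bipoly"
  assumes B: "rows32 a b c d 0 e \<in> BalH n" and n: "n div 2 > 0" and ind: "lin_indep [a, c, e]"
    and bd: "b \<in> bspan [a, c, e]" "d \<in> bspan [a, c, e]"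
    and roots: "\<And>f :: 'a poly. Polynomial.degree f = 2 \<Longrightarrow> \<exists>x. poly f x = 0"
  shows "classified n (rows32 a b c d 0 e)"
proof -
  obtain p q g where b: "b = \<kappa> p * a + \<kappa> q * c + \<kappa> g * e" using bd(1) by (rule bspan_3E)
  obtain r s h where d: "d = \<kappa> r * a + \<kappa> s * c + \<kappa> h * e" using bd(2) by (rule bspan_3E)
  obtain u v l where uv: "u \<noteq> 0 \<or> v \<noteq> 0" and eig: "u * p + v * r = l * u" "u * q + v * s = l * v"
    using left_eigenvector2[OF roots] .
  obtain x y where xy: "x * v - y * u \<noteq> 0" using uv by (rule complete_to_basis2)
  \<comment> \<open>The primed entries belong to the new basis with rows \<open>(x, y)\<close> and \<open>(u, v)\<close>; \<open>b0\<close> and \<open>d0\<close> are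
    the old entries without their multiples of \<open>e\<close>.\<close>
  define a' c' where "a' = \<kappa> x * a + \<kappa> y * c" and "c' = \<kappa> u * a + \<kappa> v * c"
  define b0 d0 where "b0 = \<kappa> p * a + \<kappa> q * c" and "d0 = \<kappa> r * a + \<kappa> s * c"
  define b' where "b' = \<kappa> x * b0 + \<kappa> y * d0"
  have d': "\<kappa> u * b0 + \<kappa> v * d0 = \<kappa> l * c'"
  proof -
    have "\<kappa> u * b0 + \<kappa> v * d0 = \<kappa> (u * p + v * r) * a + \<kappa> (u * q + v * s) * c"
      by (simp add: b0_def d0_def const_bipoly_hom algebra_simps)
    also have "\<dots> = \<kappa> l * c'"
      unfolding eig c'_def by (simp add: const_bipoly_hom algebra_simps)
    finally show ?thesis .
  qed
  have "rows32 a b c d 0 e \<approx> rows32 a b0 c d0 0 e"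
    using row_operation[of 1 0 "- g" 0 1 "- h" 0 0 1 a b c d 0 e]
    by (simp add: elementary_simps b d b0_def d0_def)
  also have "\<dots> \<approx> rows32 a' b' c' (\<kappa> l * c') 0 e"
    using row_operation[of x y 0 u v 0 0 0 1 a b0 c d0 0 e] xy d'
    by (simp add: elementary_simps a'_def b'_def c'_def)
  also have "\<dots> \<approx> rows32 a' (b' - \<kappa> l * a') c' 0 0 e"
    using column_operation[of 1 0 "- l" 1 a' b' c' "\<kappa> l * c'" 0 e]
    by (simp add: elementary_simps)
  finally show ?thesis
  proof (rule classified_reduce[OF B])
    assume B': "rows32 a' (b' - \<kappa> l * a') c' 0 0 e \<in> BalH n"
    have ind': "lin_indep [a', c', e]"
      unfolding a'_def c'_def using ind xy by (rule lin_indep_mix)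
    define k where "k = 1 / (x * v - y * u)"
    have k: "k * (x * v - y * u) = 1" using xy by (simp add: k_def)
    have "\<kappa> k * (\<kappa> v * a' - \<kappa> y * c') = \<kappa> (k * (x * v - y * u)) * a"
       "\<kappa> k * (\<kappa> x * c' - \<kappa> u * a') = \<kappa> (k * (x * v - y * u)) * c"
      by (simp_all add: a'_def c'_def const_bipoly_hom algebra_simps)
    then have ac: "\<kappa> k * (\<kappa> v * a' - \<kappa> y * c') = a" "\<kappa> k * (\<kappa> x * c' - \<kappa> u * a') = c"
      by (simp_all add: k const_bipoly_hom)
    have "a \<in> bspan [a', c']" "c \<in> bspan [a', c']"
      unfolding ac[symmetric] by (intro span_closed; simp)+
    then have "b' - \<kappa> l * a' \<in> bspan [a', c']"
      unfolding b'_def b0_def d0_def by (simp add: span_closed)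
    then show "classified n (rows32 a' (b' - \<kappa> l * a') c' 0 0 e)"
      by (rule classified_triangular_top[OF B' n ind'])
  qed
qed

text \<open>With \<open>b\<close> free, only the coefficient of \<open>a\<close> in \<open>d\<close> matters: the one of \<open>e\<close> is cleared by the third
  row, the one of \<open>c\<close> is adjusted by the first column. A nonzero coefficient gives the type
  \<open>(c,\<mu>\<^sub>4)\<close>, a zero one the type \<open>c,c\<close>.\<close>

lemma classified_dim4:
  assumes B: "rows32 a b c d 0 e \<in> BalH n" and ind: "lin_indep [b, a, c, e]"
    and d: "d \<in> bspan [a, c, e]"
  shows "classified n (rows32 a b c d 0 e)"
proof -
  obtain k l m where d: "d = \<kappa> k * a + \<kappa> l * c + \<kappa> m * e" using d by (rule bspan_3E)
  show ?thesis
  proof (cases "k = 0")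
    case False
    define a' b' where "a' = \<kappa> k * a" and "b' = b - \<kappa> l * a"
    have "rows32 a b c d 0 e \<approx> rows32 a b' c (a' + \<kappa> m * e) 0 e"
      using column_operation[of 1 0 "- l" 1 a b c d 0 e] by (simp add: elementary_simps d a'_def b'_def)
    also have "\<dots> \<approx> rows32 a' (\<kappa> k * b') c a' 0 e"
      using row_operation[of k 0 0 0 1 "- m" 0 0 1 a b' c "a' + \<kappa> m * e" 0 e] False
      by (simp add: elementary_simps a'_def)
    finally show ?thesis
    proof (rule classified_reduce[OF B])
      have "lin_indep [b', a, c, e]"
        unfolding b'_def using ind by (intro lin_indep_diff) (simp_all add: span_closed)
      then have "lin_indep [\<kappa> k * b', a, c, e]" using False by (rule lin_indep_scale)
      then have "lin_indep [a, \<kappa> k * b', c, e]" by (rule lin_indep_perm) auto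
      then have "lin_indep [a', \<kappa> k * b', c, e]" unfolding a'_def using False by (rule lin_indep_scale)
      then show "rows32 a' (\<kappa> k * b') c a' 0 e \<in> BalH n \<Longrightarrow> classified n (rows32 a' (\<kappa> k * b') c a' 0 e)"
        by (intro classified_normal_forms)
    qed
  next
    case True
    \<comment> \<open>Subtracting \<open>l - 1\<close> instead of \<open>l\<close> times the first column leaves \<open>c\<close> in place of \<open>d\<close>.\<close>
    define b' where "b' = b - \<kappa> (l - 1) * a"
    have "rows32 a b c d 0 e \<approx> rows32 a b' c (c + \<kappa> m * e) 0 e"
      using column_operation[of 1 0 "- (l - 1)" 1 a b c d 0 e] True
      by (simp add: elementary_simps d b'_def algebra_simps)
    also have "\<dots> \<approx> rows32 a b' c c 0 e"
      using row_operation[of 1 0 0 0 1 "- m" 0 0 1 a b' c "c + \<kappa> m * e" 0 e]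
      by (simp add: elementary_simps)
    finally show ?thesis
    proof (rule classified_reduce[OF B])
      have "lin_indep [b', a, c, e]"
        unfolding b'_def using ind by (intro lin_indep_diff) (simp_all add: span_closed)
      then have "lin_indep [a, b', c, e]" by (rule lin_indep_perm) auto
      then show "rows32 a b' c c 0 e \<in> BalH n \<Longrightarrow> classified n (rows32 a b' c c 0 e)"
        by (intro classified_normal_forms)
    qed
  qed
qed

text \<open>If \<open>e\<close> lies in the span of \<open>a\<close> and \<open>c\<close>, a row operation makes it equal to \<open>c\<close>. Otherwise the
  number of relations of \<open>b\<close> and \<open>d\<close> modulo \<open>a, c, e\<close> decides; no relation is the type
  \<open>(c,\<mu>\<^sub>5)\<close>.\<close>

lemma classified_generalized_zero:
  fixes a b c d e :: "'a::field bipoly"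
  assumes B: "rows32 a b c d 0 e \<in> BalH n" and n: "n div 2 > 0"
    and roots: "\<And>f :: 'a poly. Polynomial.degree f = 2 \<Longrightarrow> \<exists>x. poly f x = 0"
  shows "classified n (rows32 a b c d 0 e)"
proof -
  have ac: "lin_indep [a, c]" by (rule indep_first_column[OF B n])
  show ?thesis
  proof (cases "e \<in> bspan [a, c]")
    case True
    then obtain s t where e: "e = \<kappa> s * a + \<kappa> t * c" by (rule bspan_2E)
    have "s \<noteq> 0 \<or> t \<noteq> 0" using nonzero_corner[OF B n] by (auto simp: e const_bipoly_hom)
    then obtain p q where pq: "p * t - q * s \<noteq> 0" by (rule complete_to_basis2)
    have eq: "rows32 a b c d 0 e \<approx>
        rows32 (\<kappa> p * a + \<kappa> q * c) (\<kappa> p * b + \<kappa> q * d) e (\<kappa> s * b + \<kappa> t * d) 0 e"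
      using row_operation[of p q 0 s t 0 0 0 1 a b c d 0 e] pq by (simp add: elementary_simps e)
    have "lin_indep [\<kappa> p * a + \<kappa> q * c, e]"
      unfolding e using ac pq by (rule lin_indep_mix)
    then show ?thesis
      by (intro classified_reduce[OF B eq] classified_double_zero n)
  next
    case False
    then have "lin_indep [e, a, c]" using ac by (simp add: lin_indep_Cons)
    then have ace: "lin_indep [a, c, e]" by (rule lin_indep_perm) auto
    consider (dim5) "lin_indep [b, d, a, c, e]" | (dim4) "d \<in> bspan [a, c, e]" "b \<notin> bspan [a, c, e]"
      | (dim3) "d \<in> bspan [a, c, e]" "b \<in> bspan [a, c, e]"
      | (dim4') "d \<notin> bspan [a, c, e]" "b \<in> bspan [d, a, c, e]"
      using ace by (auto simp: lin_indep_Cons)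
    then show ?thesis
    proof cases
      case dim5
      then have "lin_indep [a, b, c, d, e]" by (rule lin_indep_perm) auto
      then show ?thesis by (rule classified_normal_forms(8)[OF B])
    next
      case dim4
      then have "lin_indep [b, a, c, e]" using ace by (simp add: lin_indep_Cons)
      then show ?thesis using dim4(1) by (rule classified_dim4[OF B])
    next
      case dim3
      then show ?thesis using classified_dim3[OF B n ace _ _ roots] by blast
    next
      case dim4'
      \<comment> \<open>Subtracting a multiple of the second row from the first and exchanging both leads to \<open>dim4\<close>.\<close>
      then obtain k where k: "b - \<kappa> k * d \<in> bspan [a, c, e]" unfolding bspan_Cons[of b] by blast
      let ?a = "a - \<kappa> k * c" and ?b = "b - \<kappa> k * d"
      have eq: "rows32 a b c d 0 e \<approx> rows32 c d ?a ?b 0 e"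
        using row_operation[of 0 1 0 1 "- k" 0 0 0 1 a b c d 0 e] by (simp add: elementary_simps)
      show ?thesis
      proof (rule classified_reduce[OF B eq])
        assume B': "rows32 c d ?a ?b 0 e \<in> BalH n"
        have "lin_indep [d, a, c, e]" using dim4' ace by (simp add: lin_indep_Cons)
        then have "lin_indep [a, c, d, e]" by (rule lin_indep_perm) auto
        then have "lin_indep [?a, c, d, e]" by (intro lin_indep_diff) (simp_all add: span_closed)
        then have ind: "lin_indep [d, c, ?a, e]" by (rule lin_indep_perm) auto
        have "a = ?a + \<kappa> k * c" by simp
        also have "\<dots> \<in> bspan [c, ?a, e]" by (intro span_closed; simp)
        finally have "bspan [a, c, e] \<subseteq> bspan [c, ?a, e]"
          by (intro bipoly.span_minimal) (simp_all add: span_closed bipoly.subspace_span)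
        then have "?b \<in> bspan [c, ?a, e]" using k by blast
        with B' ind show "classified n (rows32 c d ?a ?b 0 e)" by (rule classified_dim4)
      qed
    qed
  qed
qed

section \<open>Matrices without a generalized zero\<close>

text \<open>Completing the vectors of a generalized zero to bases shows that this is the existence of a
  generalized zero, in the form needed for elimination.\<close>

definition has_zero_corner :: "'a::field mat32 \<Rightarrow> bool" where
  "has_zero_corner \<phi> \<longleftrightarrow> (\<exists>a b c d e. \<phi> \<approx> rows32 a b c d 0 e)"

lemma has_zero_corner_orbit_equiv: "\<phi> \<approx> \<psi> \<Longrightarrow> has_zero_corner \<psi> \<Longrightarrow> has_zero_corner \<phi>"
  unfolding has_zero_corner_def using orbit_equiv_trans by blast

lemma has_zero_corner_dependent_column:
  assumes "\<not> lin_indep [a, c, e]"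
  shows "has_zero_corner (rows32 a b c d e f)"
proof -
  consider "a \<in> bspan [c, e]" | "c \<in> bspan [e]" | "e = 0"
    using assms by (auto simp: lin_indep_Cons lin_indep_Nil)
  then show ?thesis
  proof cases
    case 1
    then obtain k l where "a = \<kappa> k * c + \<kappa> l * e" by (rule bspan_2E)
    then have "rows32 a b c d e f \<approx> rows32 e f c d 0 (b - \<kappa> k * d - \<kappa> l * f)"
      using row_operation[of 0 0 1 0 1 0 1 "- k" "- l" a b c d e f] by (simp add: elementary_simps)
    then show ?thesis unfolding has_zero_corner_def by blast
  next
    case 2
    then obtain k where "c = \<kappa> k * e" by (rule bspan_1E)
    then have "rows32 a b c d e f \<approx> rows32 a b e f 0 (d - \<kappa> k * f)"
      using row_operation[of 1 0 0 0 0 1 0 1 "- k" a b c d e f] by (simp add: elementary_simps)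
    then show ?thesis unfolding has_zero_corner_def by blast
  next
    case 3
    then show ?thesis unfolding has_zero_corner_def using orbit_equiv_refl by blast
  qed
qed

text \<open>If the row vector \<open>(r, s, t)\<close> makes the second column \<open>l\<close> times the first one, it annihilates
  the generalized column with coordinates \<open>(-l, 1)\<close>.\<close>

lemma has_zero_corner_eigen:
  assumes "r \<noteq> 0 \<or> s \<noteq> 0 \<or> t \<noteq> 0"
    and "\<kappa> r * (b - \<kappa> l * a) + \<kappa> s * (d - \<kappa> l * c) + \<kappa> t * (f - \<kappa> l * e) = 0"
  shows "has_zero_corner (rows32 a b c d e f)"
proof -
  have eq: "rows32 a b c d e f \<approx> rows32 (b - \<kappa> l * a) a (d - \<kappa> l * c) c (f - \<kappa> l * e) e"
    using column_operation[of "- l" 1 1 0 a b c d e f] by (simp add: elementary_simps)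
  have "\<not> lin_indep [b - \<kappa> l * a, d - \<kappa> l * c, f - \<kappa> l * e]"
    using lin_indep_coeffs_zero[of "[b - \<kappa> l * a, d - \<kappa> l * c, f - \<kappa> l * e]" "[r, s, t]"] assms
    by (auto simp: lincomb_simps add.assoc)
  then show ?thesis by (rule has_zero_corner_orbit_equiv[OF eq has_zero_corner_dependent_column])
qed

text \<open>The coefficient \<open>k\<close> cannot vanish, for otherwise the last row would be proportional to \<open>(1, l)\<close>.
  Clearing \<open>l\<close> and exchanging the columns yields the type \<open>(\<emptyset>,\<mu>\<^sub>4)\<close>.\<close>

lemma classified_nozero_dim4_aux:
  assumes B: "rows32 a b c a e f \<in> BalH n" and nz: "\<not> has_zero_corner (rows32 a b c a e f)"
    and ind: "lin_indep [b, a, c, e]" and f: "f = \<kappa> k * c + \<kappa> l * e"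
  shows "classified n (rows32 a b c a e f)"
proof -
  have "k \<noteq> 0"
    using has_zero_corner_eigen[of 0 0 1 b l a a c f e] nz by (auto simp: f const_bipoly_hom)
  define a' b' where "a' = a - \<kappa> l * c" and "b' = b - \<kappa> l * a - \<kappa> l * a'"
  have "rows32 a b c a e f \<approx> rows32 a (b - \<kappa> l * a) c a' e (\<kappa> k * c)"
    using column_operation[of 1 0 "- l" 1 a b c a e f] by (simp add: elementary_simps a'_def f)
  also have "\<dots> \<approx> rows32 a' b' c a' (\<kappa> (1 / k) * e) c"
    using row_operation[of 1 "- l" 0 0 1 0 0 0 "1 / k" a "b - \<kappa> l * a" c a' e "\<kappa> k * c"] \<open>k \<noteq> 0\<close>
    by (simp add: elementary_simps const_bipoly_cancel b'_def) (simp add: a'_def)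
  also have "\<dots> \<approx> rows32 b' a' a' c c (\<kappa> (1 / k) * e)"
    using column_operation[of 0 1 1 0 a' b' c a' "\<kappa> (1 / k) * e" c] by (simp add: elementary_simps)
  finally show ?thesis
  proof (rule classified_reduce[OF B])
    have "lin_indep [b', a, c, e]"
      unfolding b'_def a'_def using ind by (intro lin_indep_diff) (simp_all add: span_closed)
    then have "lin_indep [a, b', c, e]" by (rule lin_indep_perm) auto
    then have "lin_indep [a', b', c, e]"
      unfolding a'_def by (intro lin_indep_diff) (simp_all add: span_closed)
    then have "lin_indep [e, b', a', c]" by (rule lin_indep_perm) auto
    then have "lin_indep [\<kappa> (1 / k) * e, b', a', c]" using \<open>k \<noteq> 0\<close> by (intro lin_indep_scale) auto
    then have "lin_indep [b', a', c, \<kappa> (1 / k) * e]" by (rule lin_indep_perm) auto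
    then show "rows32 b' a' a' c c (\<kappa> (1 / k) * e) \<in> BalH n \<Longrightarrow>
        classified n (rows32 b' a' a' c c (\<kappa> (1 / k) * e))"
      by (intro classified_normal_forms)
  qed
qed

text \<open>The entries \<open>d\<close> and \<open>f\<close> are combinations of the first column. If \<open>a\<close> occurs in one of them, that
  entry can replace \<open>a\<close>. Otherwise \<open>(d, f)\<close> is given by a \<open>2 \<times> 2\<close> matrix acting on \<open>(c, e)\<close>, and
  an eigenvector of it is a generalized zero.\<close>

lemma classified_nozero_dim4:
  fixes a b c d e f :: "'a::field bipoly"
  assumes B: "rows32 a b c d e f \<in> BalH n" and nz: "\<not> has_zero_corner (rows32 a b c d e f)"
    and ind: "lin_indep [b, a, c, e]" and df: "d \<in> bspan [a, c, e]" "f \<in> bspan [a, c, e]"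
    and roots: "\<And>f :: 'a poly. Polynomial.degree f = 2 \<Longrightarrow> \<exists>x. poly f x = 0"
  shows "classified n (rows32 a b c d e f)"
proof -
  \<comment> \<open>The first row is replaced by the combination that expresses \<open>d\<close>, so that \<open>d\<close> takes the place
    of \<open>a\<close>; subtracting \<open>u\<close> times the second row then removes \<open>a\<close> from \<open>f\<close>.\<close>
  have pivot: "classified n (rows32 a b c d e f)"
    if B: "rows32 a b c d e f \<in> BalH n" and nz: "\<not> has_zero_corner (rows32 a b c d e f)"
    and ind: "lin_indep [b, a, c, e]" and d: "d = \<kappa> k * a + \<kappa> l * c + \<kappa> m * e"
    and f: "f \<in> bspan [a, c, e]" and "k \<noteq> 0" for a b c d e f :: "'a bipoly" and k l m
  proof -
    obtain p q r where f: "f = \<kappa> p * a + \<kappa> q * c + \<kappa> r * e" using f by (rule bspan_3E)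
    define u where "u = p / k"
    have p: "p = u * k" using \<open>k \<noteq> 0\<close> by (simp add: u_def)
    define b' e' f' where "b' = \<kappa> k * b + \<kappa> l * d + \<kappa> m * f" and "e' = e - \<kappa> u * c" and
      "f' = f - \<kappa> u * d"
    have eq: "rows32 a b c d e f \<approx> rows32 d b' c d e' f'"
      using row_operation[of k l m 0 1 0 0 "- u" 1 a b c d e f] \<open>k \<noteq> 0\<close>
      by (simp add: elementary_simps b'_def e'_def f'_def) (simp add: d)
    have f': "f' = \<kappa> (q - u * l + (r - u * m) * u) * c + \<kappa> (r - u * m) * e'"
      by (simp add: f'_def e'_def f d p const_bipoly_hom algebra_simps)
    have "lin_indep [a, b, c, e]" by (rule lin_indep_perm[OF ind]) auto
    then have "lin_indep [\<kappa> k * a, b, c, e]" using \<open>k \<noteq> 0\<close> by (rule lin_indep_scale)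
    then have "lin_indep [d, b, c, e]"
      unfolding d add.assoc by (rule lin_indep_add) (simp add: span_closed)
    then have "lin_indep [b, d, c, e]" by (rule lin_indep_perm) auto
    then have "lin_indep [\<kappa> k * b, d, c, e]" using \<open>k \<noteq> 0\<close> by (rule lin_indep_scale)
    moreover have "f' \<in> bspan [d, c, e]"
      unfolding f' e'_def by (intro span_closed; simp)
    then have "\<kappa> u * d + f' \<in> bspan [d, c, e]"
      by (simp add: span_closed)
    then have "f \<in> bspan [d, c, e]"
      unfolding f'_def by (simp only: add.commute[of _ "f - _"] diff_add_cancel)
    then have "\<kappa> l * d + \<kappa> m * f \<in> bspan [d, c, e]"
      by (simp add: span_closed)
    ultimately have "lin_indep [b', d, c, e]"
      unfolding b'_def add.assoc by (rule lin_indep_add)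
    then have "lin_indep [e, b', d, c]" by (rule lin_indep_perm) auto
    then have "lin_indep [e', b', d, c]"
      unfolding e'_def by (intro lin_indep_diff) (simp_all add: span_closed)
    then have ind': "lin_indep [b', d, c, e']" by (rule lin_indep_perm) auto
    have "\<not> has_zero_corner (rows32 d b' c d e' f')" using nz has_zero_corner_orbit_equiv[OF eq] by blast
    then show ?thesis
      by (intro classified_reduce[OF B eq] classified_nozero_dim4_aux[OF _ _ ind' f'])
  qed
  obtain k l m where d: "d = \<kappa> k * a + \<kappa> l * c + \<kappa> m * e" using df(1) by (rule bspan_3E)
  obtain p q r where f: "f = \<kappa> p * a + \<kappa> q * c + \<kappa> r * e" using df(2) by (rule bspan_3E)
  consider "k \<noteq> 0" | "p \<noteq> 0" | "k = 0" "p = 0" by blast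
  then show ?thesis
  proof cases
    case 1
    then show ?thesis using pivot[OF B nz ind d df(2)] by blast
  next
    case 2
    have eq: "rows32 a b c d e f \<approx> rows32 a b e f c d"
      using row_operation[of 1 0 0 0 0 1 0 1 0 a b c d e f] by (simp add: elementary_simps)
    have ind': "lin_indep [b, a, e, c]" by (rule lin_indep_perm[OF ind]) auto
    have f': "f = \<kappa> p * a + \<kappa> r * e + \<kappa> q * c" by (simp add: f)
    have d': "d \<in> bspan [a, e, c]" using df(1) by (simp add: insert_commute)
    have "\<not> has_zero_corner (rows32 a b e f c d)" using nz has_zero_corner_orbit_equiv[OF eq] by blast
    then show ?thesis
      using 2 by (intro classified_reduce[OF B eq] pivot[OF _ _ ind' f' d'])
  next
    case 3
    obtain u v x where uv: "u \<noteq> 0 \<or> v \<noteq> 0" and eig: "u * l + v * q = x * u" "u * m + v * r = x * v"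
      using left_eigenvector2[OF roots] .
    have "\<kappa> u * d + \<kappa> v * f = \<kappa> (u * l + v * q) * c + \<kappa> (u * m + v * r) * e"
      by (simp add: d f 3 const_bipoly_hom algebra_simps)
    also have "\<dots> = \<kappa> u * (\<kappa> x * c) + \<kappa> v * (\<kappa> x * e)"
      unfolding eig by (simp add: const_bipoly_hom algebra_simps)
    finally have "\<kappa> u * (d - \<kappa> x * c) + \<kappa> v * (f - \<kappa> x * e) = 0"
      unfolding right_diff_distrib add_diff_add[symmetric] by (rule right_minus_eq[THEN iffD2])
    then have "has_zero_corner (rows32 a b c d e f)"
      using uv has_zero_corner_eigen[of 0 u v b x a d c f e] by (simp add: const_bipoly_hom)
    with nz show ?thesis by blast
  qed
qed

text \<open>The multiple of \<open>e\<close> in \<open>f\<close> is cleared by a column operation; what is left is a nonzero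
  combination of \<open>a\<close> and \<open>c\<close> and can be taken as the new \<open>a\<close>. This is the type \<open>(\<emptyset>,\<mu>\<^sub>5)\<close>.\<close>

lemma classified_nozero_dim5:
  assumes B: "rows32 a b c d e f \<in> BalH n" and nz: "\<not> has_zero_corner (rows32 a b c d e f)"
    and ind: "lin_indep [b, d, a, c, e]" and f: "f \<in> bspan [a, c, e]"
  shows "classified n (rows32 a b c d e f)"
proof -
  obtain k l m where f: "f = \<kappa> k * a + \<kappa> l * c + \<kappa> m * e" using f by (rule bspan_3E)
  have "k \<noteq> 0 \<or> l \<noteq> 0"
    using has_zero_corner_eigen[of 0 0 1 b m a d c f e] nz by (auto simp: f const_bipoly_hom)
  then have "l \<noteq> 0 \<or> k \<noteq> 0" by blast
  then obtain p q where "p * k - q * l \<noteq> 0" by (rule complete_to_basis2)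
  then have pq: "k * p - l * q \<noteq> 0" by (simp add: mult.commute)
  define b' d' where "b' = b - \<kappa> m * a" and "d' = d - \<kappa> m * c"
  define a1 b1 c1 d1 where "a1 = \<kappa> k * a + \<kappa> l * c" and "b1 = \<kappa> k * b' + \<kappa> l * d'"
    and "c1 = \<kappa> q * a + \<kappa> p * c" and "d1 = \<kappa> q * b' + \<kappa> p * d'"
  have "rows32 a b c d e f \<approx> rows32 a b' c d' e a1"
    using column_operation[of 1 0 "- m" 1 a b c d e f] by (simp add: elementary_simps f a1_def b'_def d'_def)
  also have "\<dots> \<approx> rows32 a1 b1 c1 d1 e a1"
    using row_operation[of k l 0 q p 0 0 0 1 a b' c d' e a1] pq
    by (simp add: elementary_simps a1_def b1_def c1_def d1_def)
  finally show ?thesis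
  proof (rule classified_reduce[OF B])
    have "lin_indep [b', d, a, c, e]"
      unfolding b'_def using ind by (intro lin_indep_diff) (simp_all add: span_closed)
    then have "lin_indep [d, b', a, c, e]" by (rule lin_indep_perm) auto
    then have "lin_indep [d', b', a, c, e]"
      unfolding d'_def by (intro lin_indep_diff) (simp_all add: span_closed)
    then have "lin_indep [b', d', a, c, e]" by (rule lin_indep_perm) auto
    then have "lin_indep [b1, d1, a, c, e]" unfolding b1_def d1_def using pq by (rule lin_indep_mix)
    then have "lin_indep [a, c, b1, d1, e]" by (rule lin_indep_perm) auto
    then have "lin_indep [a1, c1, b1, d1, e]" unfolding a1_def c1_def using pq by (rule lin_indep_mix)
    then have "lin_indep [a1, b1, c1, d1, e]" by (rule lin_indep_perm) auto
    then show "rows32 a1 b1 c1 d1 e a1 \<in> BalH n \<Longrightarrow> classified n (rows32 a1 b1 c1 d1 e a1)"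
      by (intro classified_normal_forms)
  qed
qed

lemma has_zero_corner_dim3:
  fixes a b c d e f :: "'a::field bipoly"
  assumes "b \<in> bspan [a, c, e]" "d \<in> bspan [a, c, e]" "f \<in> bspan [a, c, e]"
    and roots: "\<And>f :: 'a poly. Polynomial.degree f = 3 \<Longrightarrow> \<exists>x. poly f x = 0"
  shows "has_zero_corner (rows32 a b c d e f)"
proof -
  obtain p1 p2 p3 where b: "b = \<kappa> p1 * a + \<kappa> p2 * c + \<kappa> p3 * e" using assms(1) by (rule bspan_3E)
  obtain q1 q2 q3 where d: "d = \<kappa> q1 * a + \<kappa> q2 * c + \<kappa> q3 * e" using assms(2) by (rule bspan_3E)
  obtain r1 r2 r3 where f: "f = \<kappa> r1 * a + \<kappa> r2 * c + \<kappa> r3 * e" using assms(3) by (rule bspan_3E)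
  obtain u v w l where uvw: "u \<noteq> 0 \<or> v \<noteq> 0 \<or> w \<noteq> 0" and eig: "u * p1 + v * q1 + w * r1 = l * u"
     "u * p2 + v * q2 + w * r2 = l * v" "u * p3 + v * q3 + w * r3 = l * w"
    using left_eigenvector3[OF roots] .
  have "\<kappa> u * b + \<kappa> v * d + \<kappa> w * f = \<kappa> (u * p1 + v * q1 + w * r1) * a +
      \<kappa> (u * p2 + v * q2 + w * r2) * c + \<kappa> (u * p3 + v * q3 + w * r3) * e"
    by (simp add: b d f const_bipoly_hom algebra_simps)
  also have "\<dots> = \<kappa> u * (\<kappa> l * a) + \<kappa> v * (\<kappa> l * c) + \<kappa> w * (\<kappa> l * e)"
    unfolding eig by (simp add: const_bipoly_hom algebra_simps)
  finally have "\<kappa> u * (b - \<kappa> l * a) + \<kappa> v * (d - \<kappa> l * c) + \<kappa> w * (f - \<kappa> l * e) = 0"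
    unfolding right_diff_distrib add_diff_add[symmetric] by (rule right_minus_eq[THEN iffD2])
  with uvw show ?thesis by (rule has_zero_corner_eigen)
qed

text \<open>Given one relation, placed in the third row, the case distinction is on the number of further
  relations between \<open>b\<close> and \<open>d\<close> modulo the first column.\<close>

lemma classified_nozero_row3:
  fixes a b c d e f :: "'a::field bipoly"
  assumes B: "rows32 a b c d e f \<in> BalH n" and nz: "\<not> has_zero_corner (rows32 a b c d e f)"
    and ind: "lin_indep [a, c, e]" and f: "f \<in> bspan [a, c, e]"
    and roots: "\<And>f :: 'a poly. Polynomial.degree f = 2 \<or> Polynomial.degree f = 3 \<Longrightarrow> \<exists>x. poly f x = 0"
  shows "classified n (rows32 a b c d e f)"
proof -
  have roots2: "\<And>f :: 'a poly. Polynomial.degree f = 2 \<Longrightarrow> \<exists>x. poly f x = 0"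
    and roots3: "\<And>f :: 'a poly. Polynomial.degree f = 3 \<Longrightarrow> \<exists>x. poly f x = 0"
    using roots by auto
  consider (dim5) "lin_indep [b, d, a, c, e]" | (dim4) "d \<in> bspan [a, c, e]" "b \<notin> bspan [a, c, e]"
    | (dim3) "d \<in> bspan [a, c, e]" "b \<in> bspan [a, c, e]"
    | (dim4') "d \<notin> bspan [a, c, e]" "b \<in> bspan [d, a, c, e]"
    using ind by (auto simp: lin_indep_Cons)
  then show ?thesis
  proof cases
    case dim5
    then show ?thesis using f by (rule classified_nozero_dim5[OF B nz])
  next
    case dim4
    then have "lin_indep [b, a, c, e]" using ind by (simp add: lin_indep_Cons)
    then show ?thesis using classified_nozero_dim4[OF B nz _ dim4(1) f roots2] by blast
  next
    case dim3
    then show ?thesis using has_zero_corner_dim3[OF _ _ f roots3] nz by blast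
  next
    case dim4'
    \<comment> \<open>Subtracting a multiple of the second row from the first and exchanging both leads to \<open>dim4\<close>.\<close>
    then obtain k where k: "b - \<kappa> k * d \<in> bspan [a, c, e]" unfolding bspan_Cons[of b] by blast
    let ?a = "a - \<kappa> k * c" and ?b = "b - \<kappa> k * d"
    have eq: "rows32 a b c d e f \<approx> rows32 c d ?a ?b e f"
      using row_operation[of 0 1 0 1 "- k" 0 0 0 1 a b c d e f] by (simp add: elementary_simps)
    have "lin_indep [d, a, c, e]" using dim4' ind by (simp add: lin_indep_Cons)
    then have "lin_indep [a, c, d, e]" by (rule lin_indep_perm) auto
    then have "lin_indep [?a, c, d, e]" by (intro lin_indep_diff) (simp_all add: span_closed)
    then have ind': "lin_indep [d, c, ?a, e]" by (rule lin_indep_perm) auto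
    have "a = ?a + \<kappa> k * c" by simp
    also have "\<dots> \<in> bspan [c, ?a, e]" by (intro span_closed; simp)
    finally have "bspan [a, c, e] \<subseteq> bspan [c, ?a, e]"
      by (intro bipoly.span_minimal) (simp_all add: span_closed bipoly.subspace_span)
    then have "?b \<in> bspan [c, ?a, e]" "f \<in> bspan [c, ?a, e]" using k f by blast+
    moreover have "\<not> has_zero_corner (rows32 c d ?a ?b e f)" using nz has_zero_corner_orbit_equiv[OF eq] by blast
    ultimately show ?thesis
      using classified_reduce[OF B eq] classified_nozero_dim4[OF _ _ ind' _ _ roots2] by blast
  qed
qed

text \<open>Either the second column is independent of the first, which is the type \<open>(\<emptyset>,\<mu>\<^sub>6)\<close>, or a relation
  can be moved to the third row.\<close>

lemma classified_nozero:
  fixes a b c d e f :: "'a::field bipoly"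
  assumes B: "rows32 a b c d e f \<in> BalH n" and nz: "\<not> has_zero_corner (rows32 a b c d e f)"
    and roots: "\<And>f :: 'a poly. Polynomial.degree f = 2 \<or> Polynomial.degree f = 3 \<Longrightarrow> \<exists>x. poly f x = 0"
  shows "classified n (rows32 a b c d e f)"
proof -
  have ind: "lin_indep [a, c, e]" using nz has_zero_corner_dependent_column by blast
  consider (dim6) "lin_indep [b, d, f, a, c, e]" | (row3) "f \<in> bspan [a, c, e]"
    | (row2) "d \<in> bspan [f, a, c, e]" | (row1) "b \<in> bspan [d, f, a, c, e]"
    using ind by (auto simp: lin_indep_Cons)
  then show ?thesis
  proof cases
    case dim6
    then have "lin_indep [a, b, c, d, e, f]" by (rule lin_indep_perm) auto
    then show ?thesis by (rule classified_normal_forms(11)[OF B])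
  next
    case row3
    then show ?thesis using classified_nozero_row3[OF B nz ind _ roots] by blast
  next
    case row2
    then obtain k where k: "d - \<kappa> k * f \<in> bspan [a, c, e]" unfolding bspan_Cons[of d] by blast
    let ?c = "c - \<kappa> k * e" and ?d = "d - \<kappa> k * f"
    have eq: "rows32 a b c d e f \<approx> rows32 a b e f ?c ?d"
      using row_operation[of 1 0 0 0 0 1 0 1 "- k" a b c d e f] by (simp add: elementary_simps)
    have nz': "\<not> has_zero_corner (rows32 a b e f ?c ?d)" using nz has_zero_corner_orbit_equiv[OF eq] by blast
    have "c = ?c + \<kappa> k * e" by simp
    also have "\<dots> \<in> bspan [a, e, ?c]" by (intro span_closed; simp)
    finally have "bspan [a, c, e] \<subseteq> bspan [a, e, ?c]"
      by (intro bipoly.span_minimal) (simp_all add: span_closed bipoly.subspace_span)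
    then have "?d \<in> bspan [a, e, ?c]" using k by blast
    moreover have "lin_indep [a, e, ?c]" using nz' has_zero_corner_dependent_column by blast
    ultimately show ?thesis
      using classified_reduce[OF B eq] classified_nozero_row3[OF _ nz' _ _ roots] by blast
  next
    case row1
    then obtain k l where k: "b - \<kappa> k * d - \<kappa> l * f \<in> bspan [a, c, e]"
      unfolding bspan_Cons[of b d] bspan_Cons[of _ f] by blast
    let ?a = "a - \<kappa> k * c - \<kappa> l * e" and ?b = "b - \<kappa> k * d - \<kappa> l * f"
    have eq: "rows32 a b c d e f \<approx> rows32 e f c d ?a ?b"
      using row_operation[of 0 0 1 0 1 0 1 "- k" "- l" a b c d e f] by (simp add: elementary_simps)
    have nz': "\<not> has_zero_corner (rows32 e f c d ?a ?b)" using nz has_zero_corner_orbit_equiv[OF eq] by blast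
    have "a = ?a + \<kappa> k * c + \<kappa> l * e" by simp
    also have "\<dots> \<in> bspan [e, c, ?a]" by (intro span_closed; simp)
    finally have "bspan [a, c, e] \<subseteq> bspan [e, c, ?a]"
      by (intro bipoly.span_minimal) (simp_all add: span_closed bipoly.subspace_span)
    then have "?b \<in> bspan [e, c, ?a]" using k by blast
    moreover have "lin_indep [e, c, ?a]" using nz' has_zero_corner_dependent_column by blast
    ultimately show ?thesis
      using classified_reduce[OF B eq] classified_nozero_row3[OF _ nz' _ _ roots] by blast
  qed
qed

lemma BalH_classified:
  fixes \<phi> :: "'a::field mat32"
  assumes B: "\<phi> \<in> BalH n" and n: "n div 2 > 0"
    and roots: "\<And>f :: 'a poly. Polynomial.degree f = 2 \<or> Polynomial.degree f = 3 \<Longrightarrow> \<exists>x. poly f x = 0"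
  shows "classified n \<phi>"
proof (cases "has_zero_corner \<phi>")
  case True
  then obtain a b c d e where eq: "\<phi> \<approx> rows32 a b c d 0 e" unfolding has_zero_corner_def by blast
  then show ?thesis using classified_reduce[OF B eq] classified_generalized_zero[OF _ n] roots by blast
next
  case False
  then show ?thesis using classified_nozero B roots rows32_exhaust[of \<phi>] by metis
qed

section \<open>Separating the orbits\<close>

definition pairing :: "'a::field mat32 \<Rightarrow> 'a^3 \<Rightarrow> 'a^2 \<Rightarrow> 'a bipoly" where
  "pairing \<phi> u v = (\<Sum>i\<in>UNIV. \<Sum>j\<in>UNIV. \<kappa> (u $ i * v $ j) * \<phi> $ i $ j)"

definition generalized_zero :: "'a::field mat32 \<Rightarrow> 'a^3 \<Rightarrow> 'a^2 \<Rightarrow> bool" where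
  "generalized_zero \<phi> u v \<longleftrightarrow> u \<noteq> 0 \<and> v \<noteq> 0 \<and> pairing \<phi> u v = 0"

definition has_generalized_zero :: "'a::field mat32 \<Rightarrow> bool" where
  "has_generalized_zero \<phi> \<longleftrightarrow> (\<exists>u v. generalized_zero \<phi> u v)"

text \<open>The determinant condition says that \<open>v\<close> and \<open>v'\<close> are different points of the projective line.\<close>

definition two_zeros :: "'a::field mat32 \<Rightarrow> bool" where
  "two_zeros \<phi> \<longleftrightarrow> (\<exists>u v u' v'. generalized_zero \<phi> u v \<and> generalized_zero \<phi> u' v' \<and>
     v $ 1 * v' $ 2 - v $ 2 * v' $ 1 \<noteq> 0)"

text \<open>To first order, \<open>(u + \<epsilon> w, v - \<epsilon> z)\<close> is again a generalized zero, although \<open>(w, v)\<close> and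
  \<open>(u, z)\<close> are not: a tangent vector of the scheme of generalized zeros at \<open>(u, v)\<close> both of whose
  components are nonzero.\<close>

definition infinitely_near_zero :: "'a::field mat32 \<Rightarrow> bool" where
  "infinitely_near_zero \<phi> \<longleftrightarrow> (\<exists>u v w z. generalized_zero \<phi> u v \<and>
     pairing \<phi> w v = pairing \<phi> u z \<and> pairing \<phi> u z \<noteq> 0)"

definition entry_dim :: "'a::field mat32 \<Rightarrow> nat" where
  "entry_dim \<phi> = bipoly.dim {\<phi> $ i $ j | i j. True}"

lemma pairing_const_mat:
  "pairing (const_mat A ** \<phi> ** const_mat N) u v = pairing \<phi> (u v* A) (N *v v)"
  by (simp add: pairing_def matrix_matrix_mult_def const_mat_def vector_matrix_mult_def
      matrix_vector_mult_def sum_3 sum_2 const_bipoly_hom algebra_simps)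

lemma invertible_mult_nonzero:
  fixes A :: "'a::field^'n^'n"
  assumes "invertible A" "u \<noteq> 0"
  shows "A *v u \<noteq> 0" "u v* A \<noteq> 0"
proof -
  show "A *v u \<noteq> 0"
    using assms by (metis matrix_inv_inverse(2) matrix_vector_mul_assoc matrix_vector_mul_lid matrix_vector_mult_0_right)
  have "u v* A = 0 \<Longrightarrow> u = 0"
    using assms(1) by (metis matrix_inv_inverse(1) vector_matrix_mul_assoc vector_matrix_mul_rid vector_matrix_mult_0)
  then show "u v* A \<noteq> 0" using assms(2) by blast
qed

lemma wedge_mult:
  fixes N :: "'a::field^2^2"
  shows "(N *v v) $ 1 * (N *v w) $ 2 - (N *v v) $ 2 * (N *v w) $ 1 =
    Determinants.det N * (v $ 1 * w $ 2 - v $ 2 * w $ 1)"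
  by (simp add: matrix_vector_mult_def sum_2 det_2 algebra_simps)

text \<open>The matrices \<open>A\<close> and \<open>N\<close> carry generalized zeros of \<open>A \<phi> N\<close> to those of \<open>\<phi>\<close>; being invertible, they
  keep vectors nonzero and projective points distinct.\<close>

lemma zeros_orbit_equiv_imp:
  assumes "\<phi> \<approx> \<psi>"
  shows "has_generalized_zero \<psi> \<Longrightarrow> has_generalized_zero \<phi>"
    and "two_zeros \<psi> \<Longrightarrow> two_zeros \<phi>"
    and "infinitely_near_zero \<psi> \<Longrightarrow> infinitely_near_zero \<phi>"
proof -
  obtain A N where inv: "invertible A" "invertible N" and \<psi>: "\<psi> = const_mat A ** \<phi> ** const_mat N"
    using assms unfolding orbit_equiv_def by blast
  have zero: "generalized_zero \<phi> (u v* A) (N *v v)" if "generalized_zero \<psi> u v" for u v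
    using that invertible_mult_nonzero(2)[OF inv(1)] invertible_mult_nonzero(1)[OF inv(2)]
    by (simp add: generalized_zero_def \<psi> pairing_const_mat)
  have "Determinants.det N \<noteq> 0" using inv by (simp add: invertible_det_nz)
  then have wedge: "(N *v v) $ 1 * (N *v w) $ 2 - (N *v v) $ 2 * (N *v w) $ 1 \<noteq> 0"
    if "v $ 1 * w $ 2 - v $ 2 * w $ 1 \<noteq> 0" for v w
    using that by (simp add: wedge_mult)
  show "has_generalized_zero \<psi> \<Longrightarrow> has_generalized_zero \<phi>"
    unfolding has_generalized_zero_def using zero by blast
  show "two_zeros \<psi> \<Longrightarrow> two_zeros \<phi>"
    unfolding two_zeros_def using zero wedge by blast
  show "infinitely_near_zero \<psi> \<Longrightarrow> infinitely_near_zero \<phi>"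
    unfolding infinitely_near_zero_def using zero unfolding \<psi> pairing_const_mat by blast
qed

lemma entry_dim_orbit_equiv:
  assumes "\<phi> \<approx> \<psi>"
  shows "entry_dim \<phi> = entry_dim \<psi>"
proof -
  have span: "bipoly.span {\<psi> $ i $ j | i j. True} \<subseteq> bipoly.span {\<phi> $ i $ j | i j. True}"
    if "\<phi> \<approx> \<psi>" for \<phi> \<psi> :: "'a mat32"
  proof (rule bipoly.span_minimal[OF _ bipoly.subspace_span])
    obtain A N where \<psi>: "\<psi> = const_mat A ** \<phi> ** const_mat N"
      using \<open>\<phi> \<approx> \<psi>\<close> unfolding orbit_equiv_def by blast
    have "\<phi> $ i $ j \<in> bipoly.span {\<phi> $ i $ j | i j. True}" for i j
      by (rule bipoly.span_base) blast
    then have "\<psi> $ i $ j \<in> bipoly.span {\<phi> $ i $ j | i j. True}" for i j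
      unfolding \<psi>
      by (auto simp: matrix_matrix_mult_def const_mat_def mult.commute[of _ "\<kappa> _"]
          intro!: bipoly.span_sum span_const_mult)
    then show "{\<psi> $ i $ j | i j. True} \<subseteq> bipoly.span {\<phi> $ i $ j | i j. True}" by blast
  qed
  show ?thesis
    unfolding entry_dim_def
    using span[OF assms] span[OF orbit_equiv_sym[OF assms]] by (intro bipoly.span_eq_dim) blast
qed

text \<open>A description of each orbit set by invariants, chosen with just enough conditions to make the
  eleven descriptions mutually exclusive.\<close>

fun orbit_type :: "ECP \<Rightarrow> 'a::field mat32 \<Rightarrow> bool" where
  "orbit_type Mu2 \<phi> \<longleftrightarrow> entry_dim \<phi> = 2"
| "orbit_type C_Col_C_Col_C \<phi> \<longleftrightarrow> entry_dim \<phi> = 3 \<and> infinitely_near_zero \<phi> \<and> \<not> two_zeros \<phi>"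
| "orbit_type C_Col_C_Com_C \<phi> \<longleftrightarrow> entry_dim \<phi> = 3 \<and> infinitely_near_zero \<phi> \<and> two_zeros \<phi>"
| "orbit_type C_Com_C_Com_C \<phi> \<longleftrightarrow> entry_dim \<phi> = 3 \<and> \<not> infinitely_near_zero \<phi>"
| "orbit_type C_Col_C \<phi> \<longleftrightarrow> entry_dim \<phi> = 4 \<and> infinitely_near_zero \<phi>"
| "orbit_type C_Com_C \<phi> \<longleftrightarrow> entry_dim \<phi> = 4 \<and> \<not> infinitely_near_zero \<phi> \<and> two_zeros \<phi>"
| "orbit_type C_Mu4 \<phi> \<longleftrightarrow> entry_dim \<phi> = 4 \<and> \<not> infinitely_near_zero \<phi> \<and> \<not> two_zeros \<phi> \<and>
     has_generalized_zero \<phi>"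
| "orbit_type C_Mu5 \<phi> \<longleftrightarrow> entry_dim \<phi> = 5 \<and> has_generalized_zero \<phi>"
| "orbit_type Empty_Mu4 \<phi> \<longleftrightarrow> entry_dim \<phi> = 4 \<and> \<not> has_generalized_zero \<phi>"
| "orbit_type Empty_Mu5 \<phi> \<longleftrightarrow> entry_dim \<phi> = 5 \<and> \<not> has_generalized_zero \<phi>"
| "orbit_type Empty_Mu6 \<phi> \<longleftrightarrow> entry_dim \<phi> = 6"

lemma two_zeros_imp_zero: "two_zeros \<phi> \<Longrightarrow> has_generalized_zero \<phi>"
  and infinitely_near_zero_imp_zero: "infinitely_near_zero \<phi> \<Longrightarrow> has_generalized_zero \<phi>"
  unfolding two_zeros_def infinitely_near_zero_def has_generalized_zero_def by blast+

lemma orbit_type_unique: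
  assumes s: "orbit_type s \<phi>" and t: "orbit_type t \<phi>"
  shows "s = t"
proof -
  have *: "\<not> two_zeros \<phi> \<and> \<not> infinitely_near_zero \<phi>" if "\<not> has_generalized_zero \<phi>"
    using that two_zeros_imp_zero infinitely_near_zero_imp_zero by blast
  show ?thesis
    using s by (cases s) (use t * in \<open>(cases t; simp)+\<close>)
qed

lemma orbit_type_orbit_equiv:
  assumes "\<phi> \<approx> \<psi>" "orbit_type s \<phi>"
  shows "orbit_type s \<psi>"
proof -
  have "has_generalized_zero \<phi> \<longleftrightarrow> has_generalized_zero \<psi>"
    "two_zeros \<phi> \<longleftrightarrow> two_zeros \<psi>" "infinitely_near_zero \<phi> \<longleftrightarrow> infinitely_near_zero \<psi>"
    using zeros_orbit_equiv_imp[OF assms(1)] zeros_orbit_equiv_imp[OF orbit_equiv_sym[OF assms(1)]]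
    by blast+
  then show ?thesis
    using assms(2) entry_dim_orbit_equiv[OF assms(1)] by (cases s) auto
qed

lemma entry_dim_rows32:
  assumes "lin_indep Qs" "set Qs \<subseteq> {a, b, c, d, e, f}" "{a, b, c, d, e, f} \<subseteq> insert 0 (set Qs)"
  shows "entry_dim (rows32 a b c d e f) = length Qs"
proof -
  have "{rows32 a b c d e f $ i $ j | i j. True} = {a, b, c, d, e, f}"
  proof -
    have "{rows32 a b c d e f $ i $ j | i j. True} = (\<Union>i\<in>UNIV. \<Union>j\<in>UNIV. {rows32 a b c d e f $ i $ j})"
      by blast
    then show ?thesis by (simp add: UNIV_2 UNIV_3 rows32_def insert_commute)
  qed
  moreover have "bipoly.span {a, b, c, d, e, f} = bspan Qs"
    using bipoly.span_mono[OF assms(2)] bipoly.span_mono[OF assms(3)] bipoly.span_insert_0 by blast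
  ultimately show ?thesis
    unfolding entry_dim_def using dim_bspan[OF assms(1)] bipoly.span_eq_dim by metis
qed

lemma lincomb_eq_iff:
  assumes "lin_indep Qs" "length ks = length Qs" "length ls = length Qs"
  shows "lincomb ks Qs = lincomb ls Qs \<longleftrightarrow> ks = ls"
proof
  have diff: "lincomb (map2 (-) ks ls) Qs = lincomb ks Qs - lincomb ls Qs"
    using assms(2,3)
  proof (induction Qs arbitrary: ks ls)
    case (Cons Q Qs)
    then obtain k ks' l ls' where "ks = k # ks'" "ls = l # ls'" by (metis length_Suc_conv)
    with Cons show ?case by (simp add: lincomb_simps const_bipoly_hom algebra_simps)
  qed (simp add: lincomb_simps)
  assume "lincomb ks Qs = lincomb ls Qs"
  then have "\<forall>k\<in>set (map2 (-) ks ls). k = 0"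
    using assms by (intro lin_indep_coeffs_zero[of Qs]) (simp_all add: diff)
  moreover have "length ks = length ls" using assms by simp
  ultimately show "ks = ls" by (induction ks ls rule: list_induct2') simp_all
qed simp

lemma lincomb_zero_iff:
  assumes "lin_indep Qs" "length ks = length Qs"
  shows "lincomb ks Qs = 0 \<longleftrightarrow> (\<forall>k\<in>set ks. k = 0)"
proof
  assume "\<forall>k\<in>set ks. k = 0"
  with assms(2) show "lincomb ks Qs = 0"
    by (induction ks Qs rule: list_induct2) (simp_all add: lincomb_simps const_bipoly_hom)
qed (use lin_indep_coeffs_zero[OF assms] in blast)

lemma pairing_rows32:
  "pairing (rows32 a b c d e f) u v = \<kappa> (u $ 1 * v $ 1) * a + \<kappa> (u $ 1 * v $ 2) * b +
     \<kappa> (u $ 2 * v $ 1) * c + \<kappa> (u $ 2 * v $ 2) * d + \<kappa> (u $ 3 * v $ 1) * e + \<kappa> (u $ 3 * v $ 2) * f"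
  by (simp add: pairing_def rows32_def sum_3 sum_2)

lemma vec_nonzero_iff:
  "(u :: 'a::zero^3) \<noteq> 0 \<longleftrightarrow> u $ 1 \<noteq> 0 \<or> u $ 2 \<noteq> 0 \<or> u $ 3 \<noteq> 0"
  "(v :: 'a::zero^2) \<noteq> 0 \<longleftrightarrow> v $ 1 \<noteq> 0 \<or> v $ 2 \<noteq> 0"
  by (auto simp: Finite_Cartesian_Product.vec_eq_iff forall_3 forall_2)

text \<open>Since the forms in a normal form are independent, \<open>u\<^sup>T \<phi> v = 0\<close> is a system of bilinear equations
  over \<open>k\<close>, one for each form. In the normal forms with a corner \<open>0\<close>, the vectors \<open>(0, 0, 1)\<close> and
  \<open>(1, 0)\<close> are a generalized zero.\<close>

lemma M_Bal_orbit_type: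
  fixes \<phi> :: "'a::field mat32"
  assumes "\<phi> \<in> M_Bal n s"
  shows "orbit_type s \<phi>"
proof (cases s)
  case Mu2
  then obtain a b where \<phi>: "\<phi> = rows32 a 0 b a 0 b" and ind: "lin_indep [a, b]"
    using assms by (auto simp: indep_forms_iff)
  have dim: "entry_dim \<phi> = 2"
    unfolding \<phi> using entry_dim_rows32[OF ind, of a 0 b a 0 b] by simp
  show ?thesis using dim by (simp add: Mu2)
next
  case C_Col_C_Col_C
  then obtain a b c where \<phi>: "\<phi> = rows32 a b c a 0 c" and ind: "lin_indep [a, b, c]"
    using assms by (auto simp: indep_forms_iff)
  have dim: "entry_dim \<phi> = 3"
    unfolding \<phi> using entry_dim_rows32[OF ind, of a b c a 0 c] by simp
  have pairing: "pairing \<phi> u v =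
      lincomb [u $ 1 * v $ 1 + u $ 2 * v $ 2, u $ 1 * v $ 2, u $ 2 * v $ 1 + u $ 3 * v $ 2] [a, b, c]" for u v
    by (simp add: \<phi> pairing_rows32 lincomb_simps const_bipoly_hom algebra_simps)
  note zero = generalized_zero_def pairing lincomb_zero_iff[OF ind]
  have near: "infinitely_near_zero \<phi>"
    unfolding infinitely_near_zero_def
    by (rule exI[of _ "vector [0, 0, 1]"], rule exI[of _ "vector [1, 0]"],
        rule exI[of _ "vector [0, 1, 0]"], rule exI[of _ "vector [0, 1]"])
       (simp add: zero vec_nonzero_iff)
  have "v $ 2 = 0" if "generalized_zero \<phi> u v" for u v
    using that by (auto simp: zero vec_nonzero_iff)
  then have two: "\<not> two_zeros \<phi>" unfolding two_zeros_def by force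
  show ?thesis using dim near two by (simp add: C_Col_C_Col_C)
next
  case C_Col_C_Com_C
  then obtain a b c where \<phi>: "\<phi> = rows32 a 0 b c 0 b" and ind: "lin_indep [a, b, c]"
    using assms by (auto simp: indep_forms_iff)
  have dim: "entry_dim \<phi> = 3"
    unfolding \<phi> using entry_dim_rows32[OF ind, of a 0 b c 0 b] by simp
  have pairing: "pairing \<phi> u v =
      lincomb [u $ 1 * v $ 1, u $ 2 * v $ 1 + u $ 3 * v $ 2, u $ 2 * v $ 2] [a, b, c]" for u v
    by (simp add: \<phi> pairing_rows32 lincomb_simps const_bipoly_hom algebra_simps)
  note zero = generalized_zero_def pairing lincomb_zero_iff[OF ind]
  have near: "infinitely_near_zero \<phi>"
    unfolding infinitely_near_zero_def
    by (rule exI[of _ "vector [0, 0, 1]"], rule exI[of _ "vector [1, 0]"],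
        rule exI[of _ "vector [0, 1, 0]"], rule exI[of _ "vector [0, 1]"])
       (simp add: zero vec_nonzero_iff)
  have two: "two_zeros \<phi>"
    unfolding two_zeros_def
    by (rule exI[of _ "vector [0, 0, 1]"], rule exI[of _ "vector [1, 0]"],
        rule exI[of _ "vector [1, 0, 0]"], rule exI[of _ "vector [0, 1]"])
       (simp add: zero vec_nonzero_iff)
  show ?thesis using dim near two by (simp add: C_Col_C_Com_C)
next
  case C_Com_C_Com_C
  then obtain a b c where \<phi>: "\<phi> = rows32 a a b 0 0 c" and ind: "lin_indep [a, b, c]"
    using assms by (auto simp: indep_forms_iff)
  have dim: "entry_dim \<phi> = 3"
    unfolding \<phi> using entry_dim_rows32[OF ind, of a a b 0 0 c] by simp
  have pairing: "pairing \<phi> u v =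
      lincomb [u $ 1 * (v $ 1 + v $ 2), u $ 2 * v $ 1, u $ 3 * v $ 2] [a, b, c]" for u v
    by (simp add: \<phi> pairing_rows32 lincomb_simps const_bipoly_hom algebra_simps)
  note zero = generalized_zero_def pairing lincomb_zero_iff[OF ind]
  have near: "\<not> infinitely_near_zero \<phi>"
    by (auto simp: infinitely_near_zero_def zero lincomb_eq_iff[OF ind] vec_nonzero_iff)
  show ?thesis using dim near by (simp add: C_Com_C_Com_C)
next
  case C_Col_C
  then obtain a b c d where \<phi>: "\<phi> = rows32 a b c d 0 c" and ind: "lin_indep [a, b, c, d]"
    using assms by (auto simp: indep_forms_iff)
  have dim: "entry_dim \<phi> = 4"
    unfolding \<phi> using entry_dim_rows32[OF ind, of a b c d 0 c] by simp
  have pairing: "pairing \<phi> u v =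
      lincomb [u $ 1 * v $ 1, u $ 1 * v $ 2, u $ 2 * v $ 1 + u $ 3 * v $ 2, u $ 2 * v $ 2] [a, b, c, d]" for u v
    by (simp add: \<phi> pairing_rows32 lincomb_simps const_bipoly_hom algebra_simps)
  note zero = generalized_zero_def pairing lincomb_zero_iff[OF ind]
  have near: "infinitely_near_zero \<phi>"
    unfolding infinitely_near_zero_def
    by (rule exI[of _ "vector [0, 0, 1]"], rule exI[of _ "vector [1, 0]"],
        rule exI[of _ "vector [0, 1, 0]"], rule exI[of _ "vector [0, 1]"])
       (simp add: zero vec_nonzero_iff)
  show ?thesis using dim near by (simp add: C_Col_C)
next
  case C_Com_C
  then obtain a b c d where \<phi>: "\<phi> = rows32 a b c c 0 d" and ind: "lin_indep [a, b, c, d]"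
    using assms by (auto simp: indep_forms_iff)
  have dim: "entry_dim \<phi> = 4"
    unfolding \<phi> using entry_dim_rows32[OF ind, of a b c c 0 d] by simp
  have pairing: "pairing \<phi> u v =
      lincomb [u $ 1 * v $ 1, u $ 1 * v $ 2, u $ 2 * (v $ 1 + v $ 2), u $ 3 * v $ 2] [a, b, c, d]" for u v
    by (simp add: \<phi> pairing_rows32 lincomb_simps const_bipoly_hom algebra_simps)
  note zero = generalized_zero_def pairing lincomb_zero_iff[OF ind]
  have near: "\<not> infinitely_near_zero \<phi>"
    by (auto simp: infinitely_near_zero_def zero lincomb_eq_iff[OF ind] vec_nonzero_iff)
  have two: "two_zeros \<phi>"
    unfolding two_zeros_def
    by (rule exI[of _ "vector [0, 0, 1]"], rule exI[of _ "vector [1, 0]"],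
        rule exI[of _ "vector [0, 1, 0]"], rule exI[of _ "vector [1, -1]"])
       (simp add: zero vec_nonzero_iff)
  show ?thesis using dim near two by (simp add: C_Com_C)
next
  case C_Mu4
  then obtain a b c d where \<phi>: "\<phi> = rows32 a b c a 0 d" and ind: "lin_indep [a, b, c, d]"
    using assms by (auto simp: indep_forms_iff)
  have dim: "entry_dim \<phi> = 4"
    unfolding \<phi> using entry_dim_rows32[OF ind, of a b c a 0 d] by simp
  have pairing: "pairing \<phi> u v =
      lincomb [u $ 1 * v $ 1 + u $ 2 * v $ 2, u $ 1 * v $ 2, u $ 2 * v $ 1, u $ 3 * v $ 2] [a, b, c, d]" for u v
    by (simp add: \<phi> pairing_rows32 lincomb_simps const_bipoly_hom algebra_simps)
  note zero = generalized_zero_def pairing lincomb_zero_iff[OF ind]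
  have near: "\<not> infinitely_near_zero \<phi>"
    by (auto simp: infinitely_near_zero_def zero lincomb_eq_iff[OF ind] vec_nonzero_iff)
  have "v $ 2 = 0" if "generalized_zero \<phi> u v" for u v
    using that by (auto simp: zero vec_nonzero_iff)
  then have two: "\<not> two_zeros \<phi>" unfolding two_zeros_def by force
  have has: "has_generalized_zero \<phi>"
    unfolding has_generalized_zero_def
    by (rule exI[of _ "vector [0, 0, 1]"], rule exI[of _ "vector [1, 0]"])
       (simp add: zero vec_nonzero_iff)
  show ?thesis using dim near two has by (simp add: C_Mu4)
next
  case C_Mu5
  then obtain a b c d e where \<phi>: "\<phi> = rows32 a b c d 0 e" and ind: "lin_indep [a, b, c, d, e]"
    using assms by (auto simp: indep_forms_iff)
  have dim: "entry_dim \<phi> = 5"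
    unfolding \<phi> using entry_dim_rows32[OF ind, of a b c d 0 e] by simp
  have pairing: "pairing \<phi> u v =
      lincomb [u $ 1 * v $ 1, u $ 1 * v $ 2, u $ 2 * v $ 1, u $ 2 * v $ 2, u $ 3 * v $ 2] [a, b, c, d, e]" for u v
    by (simp add: \<phi> pairing_rows32 lincomb_simps const_bipoly_hom algebra_simps)
  note zero = generalized_zero_def pairing lincomb_zero_iff[OF ind]
  have has: "has_generalized_zero \<phi>"
    unfolding has_generalized_zero_def
    by (rule exI[of _ "vector [0, 0, 1]"], rule exI[of _ "vector [1, 0]"])
       (simp add: zero vec_nonzero_iff)
  show ?thesis using dim has by (simp add: C_Mu5)
next
  case Empty_Mu4
  then obtain a b c d where \<phi>: "\<phi> = rows32 a b b c c d" and ind: "lin_indep [a, b, c, d]"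
    using assms by (auto simp: indep_forms_iff)
  have dim: "entry_dim \<phi> = 4"
    unfolding \<phi> using entry_dim_rows32[OF ind, of a b b c c d] by simp
  have pairing: "pairing \<phi> u v =
      lincomb [u $ 1 * v $ 1, u $ 1 * v $ 2 + u $ 2 * v $ 1, u $ 2 * v $ 2 + u $ 3 * v $ 1, u $ 3 * v $ 2] [a, b, c, d]" for u v
    by (simp add: \<phi> pairing_rows32 lincomb_simps const_bipoly_hom algebra_simps)
  note zero = generalized_zero_def pairing lincomb_zero_iff[OF ind]
  have has: "\<not> has_generalized_zero \<phi>"
    by (auto simp: has_generalized_zero_def zero vec_nonzero_iff)
  show ?thesis using dim has by (simp add: Empty_Mu4)
next
  case Empty_Mu5
  then obtain a b c d e where \<phi>: "\<phi> = rows32 a b c d e a" and ind: "lin_indep [a, b, c, d, e]"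
    using assms by (auto simp: indep_forms_iff)
  have dim: "entry_dim \<phi> = 5"
    unfolding \<phi> using entry_dim_rows32[OF ind, of a b c d e a] by simp
  have pairing: "pairing \<phi> u v =
      lincomb [u $ 1 * v $ 1 + u $ 3 * v $ 2, u $ 1 * v $ 2, u $ 2 * v $ 1, u $ 2 * v $ 2, u $ 3 * v $ 1] [a, b, c, d, e]" for u v
    by (simp add: \<phi> pairing_rows32 lincomb_simps const_bipoly_hom algebra_simps)
  note zero = generalized_zero_def pairing lincomb_zero_iff[OF ind]
  have has: "\<not> has_generalized_zero \<phi>"
    by (auto simp: has_generalized_zero_def zero vec_nonzero_iff)
  show ?thesis using dim has by (simp add: Empty_Mu5)
next
  case Empty_Mu6
  then obtain a b c d e f where \<phi>: "\<phi> = rows32 a b c d e f" and ind: "lin_indep [a, b, c, d, e, f]"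
    using assms by (auto simp: indep_forms_iff)
  have dim: "entry_dim \<phi> = 6"
    unfolding \<phi> using entry_dim_rows32[OF ind, of a b c d e f] by simp
  show ?thesis using dim by (simp add: Empty_Mu6)
qed

lemma DO_Bal_orbit_type: "\<psi> \<in> DO_Bal n s \<Longrightarrow> orbit_type s \<psi>"
  using M_Bal_orbit_type orbit_type_orbit_equiv unfolding DO_Bal_iff by blast

lemma M_Bal_subset_BalH: "M_Bal n s \<subseteq> BalH n"
  by (cases s) auto

section \<open>The orbit decomposition\<close>

theorem theorem4p9:
  fixes d :: nat
  assumes "even d"
    and "\<And>p :: 'a::field poly. Polynomial.degree p = 2 \<or> Polynomial.degree p = 3 \<Longrightarrow>
           \<exists>a. poly p a = 0"
  shows "(BalH d :: 'a mat32 set) = (\<Union>s\<in>(UNIV :: ECP set). DO_Bal d s)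
    \<and> disjoint_family_on (DO_Bal d :: ECP \<Rightarrow> 'a mat32 set) UNIV"
proof (intro conjI equalityI subsetI)
  fix \<phi> :: "'a mat32"
  assume \<phi>: "\<phi> \<in> BalH d"
  have "d \<noteq> 0"
  proof
    assume "d = 0"
    with \<phi> show False by (simp add: BalH_0)
  qed
  then have "d div 2 > 0" using \<open>even d\<close> by (auto elim: evenE)
  then have "classified d \<phi>" by (rule BalH_classified[OF \<phi> _ assms(2)])
  then show "\<phi> \<in> (\<Union>s\<in>UNIV. DO_Bal d s)" by (simp add: classified_def)
next
  fix \<phi> :: "'a mat32"
  assume "\<phi> \<in> (\<Union>s\<in>UNIV. DO_Bal d s)"
  then obtain s \<psi> where "\<psi> \<in> M_Bal d s" "\<psi> \<approx> \<phi>" by (auto simp: DO_Bal_iff)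
  then show "\<phi> \<in> BalH d" using M_Bal_subset_BalH BalH_orbit_equiv by blast
next
  show "disjoint_family_on (DO_Bal d :: ECP \<Rightarrow> 'a mat32 set) UNIV"
    unfolding disjoint_family_on_def
    using DO_Bal_orbit_type orbit_type_unique by blast
qed

end
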